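(* Let $M^2$ be a complete proper self-shrinker in $\mathbb{R}^3$. If the squared norm $|B|^2$ of the second fundamental form is constant on $M$, then $|B|^2\equiv 0$ or $|B|^2\equiv\frac12$.
   Context: Let $M$ be a smooth $2$-dimensional Riemannian manifold without boundary and $X:M\to\mathbb{R}^{3}$ an isometric immersion; proper means that $X$ is a proper map. The second fundamental form is $B(V,W)=(\overline\nabla_V W)^N$, where $\overline\nabla$ is the flat connection and $(\cdot)^N$ is the normal projection; $|B|^2=\sum_{i,j}|B(e_i,e_j)|^2$ for a local orthonormal tangent frame $\{e_i\}$. The mean curvature vector is $H=\sum_i B(e_i,e_i)$ (no factor $1/2$). $M$ is a self-shrinker if $H=-\frac{X^N}{2}$, where $X^N$ is the normal part of the position vector $X$. *)

theory Defs
  imports "HOL-Analysis.Analysis"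
begin

section \<open>Smooth maps between Euclidean spaces\<close>

text \<open>
  \<open>Ck_on k S f\<close> is meant for open \<open>S\<close>: all iterated directional derivatives of \<open>f\<close> up to order \<open>k\<close>
  exist and are continuous on \<open>S\<close>.
\<close>

primrec Ck_on ::
  "nat \<Rightarrow> 'e::euclidean_space set \<Rightarrow> ('e \<Rightarrow> 'f::real_normed_vector) \<Rightarrow> bool" where
  "Ck_on 0 S f \<longleftrightarrow> continuous_on S f"
| "Ck_on (Suc k) S f \<longleftrightarrow>
     (\<forall>x\<in>S. f differentiable (at x)) \<and>
     (\<forall>v. Ck_on k S (\<lambda>x. frechet_derivative f (at x) v))"

definition smooth_on ::
  "'e::euclidean_space set \<Rightarrow> ('e \<Rightarrow> 'f::real_normed_vector) \<Rightarrow> bool" where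
  "smooth_on S f \<longleftrightarrow> (\<forall>k. Ck_on k S f)"


section \<open>Smooth manifolds without boundary\<close>

text \<open>
  A chart is a pair \<open>(U, \<phi>)\<close> of a domain and a coordinate map; \<open>\<phi>\<close> is irrelevant outside \<open>U\<close>.
  A manifold is a topology together with a (not necessarily maximal) smooth atlas. It need not be
  connected.
\<close>

type_synonym ('a, 'e) chart = "'a set \<times> ('a \<Rightarrow> 'e)"

definition chart_inv :: "('a, 'e) chart \<Rightarrow> 'e \<Rightarrow> 'a" where
  "chart_inv c = inv_into (fst c) (snd c)"

definition is_chart :: "'a topology \<Rightarrow> ('a, 'e::euclidean_space) chart \<Rightarrow> bool" where
  "is_chart M c \<longleftrightarrow>
     openin M (fst c) \<and> open (snd c ` fst c) \<and>
     homeomorphic_map (subtopology M (fst c)) (top_of_set (snd c ` fst c)) (snd c)"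

definition smooth_manifold :: "'a topology \<Rightarrow> ('a, 'e::euclidean_space) chart set \<Rightarrow> bool" where
  "smooth_manifold M A \<longleftrightarrow>
     Hausdorff_space M \<and> second_countable M \<and>
     (\<forall>c\<in>A. is_chart M c) \<and> (\<Union>c\<in>A. fst c) = topspace M \<and>
     (\<forall>c\<in>A. \<forall>c'\<in>A. smooth_on (snd c ` (fst c \<inter> fst c')) (snd c' \<circ> chart_inv c))"


section \<open>Riemannian metrics and completeness\<close>

text \<open>
  Tangent vectors at \<open>p\<close> are represented by their components in a chart \<open>c\<close> around \<open>p\<close>, and
  \<open>g c p v w\<close> is the inner product of the tangent vectors with components \<open>v\<close> and \<open>w\<close>. The last
  clause of \<open>riemannian_metric\<close> is the transformation law of a covariant 2-tensor.
\<close>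

type_synonym ('a, 'e) metric_tensor = "('a, 'e) chart \<Rightarrow> 'a \<Rightarrow> 'e \<Rightarrow> 'e \<Rightarrow> real"

definition riemannian_metric ::
  "('a, 'e::euclidean_space) chart set \<Rightarrow> ('a, 'e) metric_tensor \<Rightarrow> bool" where
  "riemannian_metric A g \<longleftrightarrow>
     (\<forall>c\<in>A. \<forall>p\<in>fst c.
        bilinear (g c p) \<and> (\<forall>v w. g c p v w = g c p w v) \<and> (\<forall>v. v \<noteq> 0 \<longrightarrow> 0 < g c p v v)) \<and>
     (\<forall>c\<in>A. \<forall>v w. smooth_on (snd c ` fst c) (\<lambda>x. g c (chart_inv c x) v w)) \<and>
     (\<forall>c\<in>A. \<forall>c'\<in>A. \<forall>p\<in>fst c \<inter> fst c'. \<forall>v w.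
        g c p v w =
        (let J = frechet_derivative (snd c' \<circ> chart_inv c) (at (snd c p)) in g c' p (J v) (J w)))"

text \<open>
  The Riemannian distance is the infimum of the lengths of piecewise continuously differentiable
  curves. Such a curve is a finite concatenation of continuously differentiable arcs each of which
  lies in the domain of one chart; an arc is given by its coordinate expression \<open>x\<close>.
\<close>

definition arc_length ::
  "('a, 'e::euclidean_space) metric_tensor \<Rightarrow> ('a, 'e) chart \<Rightarrow> (real \<Rightarrow> 'e) \<Rightarrow> real" where
  "arc_length g c x =
     integral {0..1} (\<lambda>t. sqrt (g c (chart_inv c (x t))
                                  (vector_derivative x (at t)) (vector_derivative x (at t))))"

inductive curve_of_length ::
  "('a, 'e::euclidean_space) chart set \<Rightarrow> ('a, 'e) metric_tensor \<Rightarrow> 'a \<Rightarrow> 'a \<Rightarrow> real \<Rightarrow> bool"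
  for A g where
  const: "curve_of_length A g p p 0"
| arc: "c \<in> A \<Longrightarrow> x C1_differentiable_on {0..1} \<Longrightarrow> x ` {0..1} \<subseteq> snd c ` fst c \<Longrightarrow>
        curve_of_length A g (chart_inv c (x 1)) q l \<Longrightarrow>
        curve_of_length A g (chart_inv c (x 0)) q (arc_length g c x + l)"

text \<open>The distance is \<open>\<infinity>\<close> between points in different connected components.\<close>

definition riemannian_dist ::
  "('a, 'e::euclidean_space) chart set \<Rightarrow> ('a, 'e) metric_tensor \<Rightarrow> 'a \<Rightarrow> 'a \<Rightarrow> ereal" where
  "riemannian_dist A g p q = Inf {ereal l | l. curve_of_length A g p q l}"

definition complete_riemannian ::
  "'a topology \<Rightarrow> ('a, 'e::euclidean_space) chart set \<Rightarrow> ('a, 'e) metric_tensor \<Rightarrow> bool" where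
  "complete_riemannian M A g \<longleftrightarrow>
     (\<forall>s::nat \<Rightarrow> 'a.
        range s \<subseteq> topspace M \<and>
        (\<forall>\<epsilon>>0. \<exists>N. \<forall>m\<ge>N. \<forall>n\<ge>N. riemannian_dist A g (s m) (s n) < ereal \<epsilon>) \<longrightarrow>
        (\<exists>p\<in>topspace M. (\<lambda>n. riemannian_dist A g (s n) p) \<longlonglongrightarrow> 0))"


section \<open>Isometric immersions\<close>

definition local_rep :: "('a \<Rightarrow> 'f) \<Rightarrow> ('a, 'e) chart \<Rightarrow> 'e \<Rightarrow> 'f" where
  "local_rep X c = X \<circ> chart_inv c"

definition isometric_immersion ::
  "('a, 'e::euclidean_space) chart set \<Rightarrow> ('a, 'e) metric_tensor \<Rightarrow>
   ('a \<Rightarrow> 'f::euclidean_space) \<Rightarrow> bool" where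
  "isometric_immersion A g X \<longleftrightarrow>
     (\<forall>c\<in>A. smooth_on (snd c ` fst c) (local_rep X c) \<and>
        (\<forall>p\<in>fst c. let dX = frechet_derivative (local_rep X c) (at (snd c p)) in
           inj dX \<and> (\<forall>v w. g c p v w = dX v \<bullet> dX w)))"


section \<open>Second fundamental form and self-shrinkers\<close>

text \<open>
  The first group of definitions concerns a parametrisation \<open>F\<close> (later: \<open>local_rep X c\<close>)
  of an immersed submanifold by an open set of Euclidean space. \<open>normal_part F x y\<close> is the component
  of \<open>y\<close> orthogonal to the tangent space at \<open>F x\<close>.
\<close>

definition tangent_space ::
  "('e::euclidean_space \<Rightarrow> 'f::euclidean_space) \<Rightarrow> 'e \<Rightarrow> 'f set" where
  "tangent_space F x = range (frechet_derivative F (at x))"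

definition normal_part ::
  "('e::euclidean_space \<Rightarrow> 'f::euclidean_space) \<Rightarrow> 'e \<Rightarrow> 'f \<Rightarrow> 'f" where
  "normal_part F x y =
     (THE n. n \<in> orthogonal_comp (tangent_space F x) \<and> y - n \<in> tangent_space F x)"

text \<open>
  The flat derivative at \<open>x\<close>, in the direction \<open>v\<close>, of the tangent field with components \<open>W\<close>.
\<close>

definition flat_connection ::
  "('e::euclidean_space \<Rightarrow> 'f::euclidean_space) \<Rightarrow> 'e \<Rightarrow> ('e \<Rightarrow> 'e) \<Rightarrow> 'e \<Rightarrow> 'f" where
  "flat_connection F v W x = frechet_derivative (\<lambda>y. frechet_derivative F (at y) (W y)) (at x) v"

text \<open>
  To evaluate \<open>B\<close> on tangent vectors with components \<open>v\<close> and \<open>w\<close>, the latter is extended to the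
  field with constant components \<open>w\<close>. By lemma \<open>normal_part_flat_connection\<close> below, every other
  extension gives the same value.
\<close>

definition second_ff ::
  "('e::euclidean_space \<Rightarrow> 'f::euclidean_space) \<Rightarrow> 'e \<Rightarrow> 'e \<Rightarrow> 'e \<Rightarrow> 'f" where
  "second_ff F x v w = normal_part F x (flat_connection F v (\<lambda>_. w) x)"

lemma normal_part_add_tangent:
  assumes "t \<in> tangent_space F x" and "linear (frechet_derivative F (at x))"
  shows "normal_part F x (y + t) = normal_part F x y"
proof -
  have sub: "subspace (tangent_space F x)"
    unfolding tangent_space_def using assms(2) by (simp add: linear_subspace_image)
  have "(y + t - n \<in> tangent_space F x) = (y - n \<in> tangent_space F x)" for n
  proof
    assume "y + t - n \<in> tangent_space F x"
    from subspace_diff[OF sub this assms(1)] show "y - n \<in> tangent_space F x" by simp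
  next
    assume "y - n \<in> tangent_space F x"
    from subspace_add[OF sub this assms(1)] show "y + t - n \<in> tangent_space F x"
      by (simp add: algebra_simps)
  qed
  then show ?thesis unfolding normal_part_def by simp
qed

lemma normal_part_flat_connection:
  assumes S: "open S" "x \<in> S" and F: "smooth_on S F" and W: "W differentiable (at x)"
  shows "normal_part F x (flat_connection F v W x) = second_ff F x v (W x)"
proof -
  let ?D = "\<lambda>y. frechet_derivative F (at y)"
  have "Ck_on 2 S F" using F by (simp add: smooth_on_def)
  then have d1: "\<And>y. y \<in> S \<Longrightarrow> F differentiable (at y)"
    and d2: "\<And>u. (\<lambda>y. ?D y u) differentiable (at x)"
    using S by (auto simp: numeral_2_eq_2)
  have lin: "linear (?D y)" if "y \<in> S" for y
    using d1[OF that] by (rule linear_frechet_derivative)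
  have expand: "?D y u = (\<Sum>b\<in>Basis. (u \<bullet> b) *\<^sub>R ?D y b)" if "y \<in> S" for y u
  proof -
    have "?D y u = ?D y (\<Sum>b\<in>Basis. (u \<bullet> b) *\<^sub>R b)"
      by (simp add: euclidean_representation)
    also have "\<dots> = (\<Sum>b\<in>Basis. (u \<bullet> b) *\<^sub>R ?D y b)"
      by (simp only: linear_sum[OF lin[OF that]] linear_scale[OF lin[OF that]])
    finally show ?thesis .
  qed
  let ?E = "\<lambda>b. frechet_derivative (\<lambda>y. ?D y b) (at x)"
  let ?W = "frechet_derivative W (at x)"
  have hE: "((\<lambda>y. ?D y b) has_derivative ?E b) (at x)" for b
    using d2[of b] by (simp only: frechet_derivative_works)
  have main: "flat_connection F v V x = (\<Sum>b\<in>Basis. (V x \<bullet> b) *\<^sub>R ?E b v) + ?D x (V' v)"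
    if V: "(V has_derivative V') (at x)" for V V'
  proof -
    have "((\<lambda>y. \<Sum>b\<in>Basis. (V y \<bullet> b) *\<^sub>R ?D y b) has_derivative
          (\<lambda>h. \<Sum>b\<in>Basis. (V x \<bullet> b) *\<^sub>R ?E b h + (V' h \<bullet> b) *\<^sub>R ?D x b)) (at x)"
      by (intro has_derivative_sum has_derivative_scaleR has_derivative_inner_left V hE)
    then have "((\<lambda>y. ?D y (V y)) has_derivative
          (\<lambda>h. \<Sum>b\<in>Basis. (V x \<bullet> b) *\<^sub>R ?E b h + (V' h \<bullet> b) *\<^sub>R ?D x b)) (at x)"
      by (rule has_derivative_transform_within_open[OF _ S]) (rule expand[symmetric])
    then have "flat_connection F v V x =
        (\<Sum>b\<in>Basis. (V x \<bullet> b) *\<^sub>R ?E b v + (V' v \<bullet> b) *\<^sub>R ?D x b)"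
      unfolding flat_connection_def by (simp only: frechet_derivative_at[symmetric])
    then show ?thesis by (simp only: sum.distrib expand[OF S(2), of "V' v", symmetric])
  qed
  have "flat_connection F v W x = (\<Sum>b\<in>Basis. (W x \<bullet> b) *\<^sub>R ?E b v) + ?D x (?W v)"
    using W by (intro main) (simp only: frechet_derivative_works)
  moreover have "flat_connection F v (\<lambda>_. W x) x = (\<Sum>b\<in>Basis. (W x \<bullet> b) *\<^sub>R ?E b v)"
    using main[OF has_derivative_const, of "W x"] linear_0[OF lin[OF S(2)]] by simp
  ultimately show ?thesis
    unfolding second_ff_def
    using normal_part_add_tangent[of "?D x (?W v)" F x] lin[OF S(2)] by (simp add: tangent_space_def)
qed

text \<open>
  The traces below do not depend on the orthonormal basis that is selected, since \<open>second_ff F x\<close> is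
  bilinear. Hence a basis at the point suffices instead of a local frame.
\<close>

definition orthonormal_frame :: "('e::euclidean_space \<Rightarrow> 'e \<Rightarrow> real) \<Rightarrow> 'e set \<Rightarrow> bool" where
  "orthonormal_frame b E \<longleftrightarrow>
     card E = DIM('e) \<and> (\<forall>u\<in>E. \<forall>v\<in>E. b u v = (if u = v then 1 else 0))"

definition frame_at :: "('a, 'e::euclidean_space) metric_tensor \<Rightarrow> ('a, 'e) chart \<Rightarrow> 'a \<Rightarrow> 'e set"
  where "frame_at g c p = (SOME E. orthonormal_frame (g c p) E)"

text \<open>
  The following quantities, computed in a chart \<open>c\<close> around \<open>p\<close>, have values independent of \<open>c\<close>.
\<close>

definition mean_curvature ::
  "('a, 'e::euclidean_space) metric_tensor \<Rightarrow> ('a \<Rightarrow> 'f::euclidean_space) \<Rightarrow>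
   ('a, 'e) chart \<Rightarrow> 'a \<Rightarrow> 'f" where
  "mean_curvature g X c p = (\<Sum>e\<in>frame_at g c p. second_ff (local_rep X c) (snd c p) e e)"

definition sff_norm_sq ::
  "('a, 'e::euclidean_space) metric_tensor \<Rightarrow> ('a \<Rightarrow> 'f::euclidean_space) \<Rightarrow>
   ('a, 'e) chart \<Rightarrow> 'a \<Rightarrow> real" where
  "sff_norm_sq g X c p =
     (\<Sum>e\<in>frame_at g c p. \<Sum>e'\<in>frame_at g c p.
        (norm (second_ff (local_rep X c) (snd c p) e e'))\<^sup>2)"

definition self_shrinker ::
  "('a, 'e::euclidean_space) chart set \<Rightarrow> ('a, 'e) metric_tensor \<Rightarrow>
   ('a \<Rightarrow> 'f::euclidean_space) \<Rightarrow> bool" where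
  "self_shrinker A g X \<longleftrightarrow>
     (\<forall>c\<in>A. \<forall>p\<in>fst c.
        mean_curvature g X c p = - (1/2) *\<^sub>R normal_part (local_rep X c) (snd c p) (X p))"

end

theory Submission
  imports Defs
begin

text \<open>
  Since \<open>X\<close> is proper, its image is closed, so \<open>|X|\<close> attains its minimum at some point \<open>p\<close>; there
  \<open>X\<close> is normal. Near \<open>p\<close> the surface is a graph \<open>f\<close> over its tangent plane, and \<open>f\<close> satisfies the
  shrinker equation together with the equation \<open>|B|\<^sup>2 = b\<close>. At \<open>p\<close> the first derivatives of
  both equations show that either all third derivatives of \<open>f\<close> vanish or \<open>p\<close> is umbilic, and
  their second derivatives combine to the Simons-type identity
  \<open>b\<^sup>2 - b/2 = 4 (f\<^sub>1\<^sub>1\<^sub>1\<^sup>2 + f\<^sub>1\<^sub>1\<^sub>2\<^sup>2)\<close>.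
  In the first case this gives \<open>b = 0\<close> or \<open>b = 1/2\<close>. In the umbilic case it gives \<open>b = 0\<close> or
  \<open>b \<ge> 1/2\<close>, while the second derivative test for \<open>|X|\<^sup>2\<close> gives \<open>b \<le> 1/2\<close>.
\<close>

section \<open>Calculus of smooth functions\<close>

text \<open>On an open set the Frechet derivative depends only on nearby values, so agreement on
  \<open>S\<close> passes to all iterated derivatives.\<close>

lemma Ck_on_cong:
  assumes "open S" "\<And>x. x \<in> S \<Longrightarrow> f x = g x" "Ck_on k S f"
  shows "Ck_on k S g"
  using assms
proof (induction k arbitrary: f g)
  case 0
  then show ?case by (simp cong: continuous_on_cong)
next
  case (Suc k)
  have D: "(g has_derivative frechet_derivative f (at x)) (at x)" if "x \<in> S" for x
  proof (rule has_derivative_transform_within_open[OF _ Suc.prems(1) that])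
    show "(f has_derivative frechet_derivative f (at x)) (at x)"
      using Suc.prems that frechet_derivative_works by auto
  qed (use Suc.prems in auto)
  show ?case
    unfolding Ck_on.simps
  proof (intro conjI ballI allI)
    show "g differentiable (at x)" if "x \<in> S" for x
      using D[OF that] by (auto simp: differentiable_def)
    show "Ck_on k S (\<lambda>x. frechet_derivative g (at x) v)" for v
    proof (rule Suc.IH[OF Suc.prems(1)])
      show "Ck_on k S (\<lambda>x. frechet_derivative f (at x) v)"
        using Suc.prems(3) by simp
      show "frechet_derivative f (at x) v = frechet_derivative g (at x) v" if "x \<in> S" for x
        using frechet_derivative_at[OF D[OF that]] by simp
    qed
  qed
qed

text \<open>Lets an explicit derivative \<open>f'\<close> stand for
  \<open>frechet_derivative\<close> in the recursive clause, by uniqueness of derivatives on the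
  open set \<open>S\<close>.\<close>

lemma Ck_on_SucI:
  assumes "open S" "\<And>x. x \<in> S \<Longrightarrow> (f has_derivative f' x) (at x)"
    and "\<And>v. Ck_on k S (\<lambda>x. f' x v)"
  shows "Ck_on (Suc k) S f"
proof -
  have "frechet_derivative f (at x) = f' x" if "x \<in> S" for x
    using frechet_derivative_at[OF assms(2)[OF that]] by simp
  then have "Ck_on k S (\<lambda>x. frechet_derivative f (at x) v)" for v
    by (intro Ck_on_cong[OF assms(1) _ assms(3)[of v]]) simp
  with assms(2) show ?thesis
    by (auto simp: differentiable_def)
qed

text \<open>At the bottom of the recursion this is continuity of differentiable maps. It serves the
  product rule, where one factor stays undifferentiated.\<close>

lemma Ck_on_SucD:
  assumes "Ck_on (Suc k) S f" shows "Ck_on k S f"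
  using assms
proof (induction k arbitrary: f)
  case 0
  then show ?case
    by (auto intro!: continuous_at_imp_continuous_on differentiable_imp_continuous_within)
next
  case (Suc k)
  have "\<forall>x\<in>S. f differentiable (at x)"
    "Ck_on (Suc k) S (\<lambda>x. frechet_derivative f (at x) v)" for v
    using Suc.prems unfolding Ck_on.simps(2)[of "Suc k"] by blast+
  then show ?case
    using Suc.IH by (subst Ck_on.simps(2)) blast
qed

lemma Ck_on_Suc_has_derivative:
  assumes "Ck_on (Suc k) S f" "x \<in> S"
  shows "(f has_derivative frechet_derivative f (at x)) (at x)"
  using assms frechet_derivative_works by auto

lemma Ck_on_const: "Ck_on k S (\<lambda>_. c)"
proof (induction k arbitrary: c)
  case 0
  then show ?case by (simp add: continuous_on_const)
next
  case (Suc k)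
  then show ?case by simp
qed

lemma Ck_on_bounded_linear:
  assumes "open S" "bounded_linear h" "Ck_on k S f"
  shows "Ck_on k S (\<lambda>x. h (f x))"
  using assms(3)
proof (induction k arbitrary: f)
  case 0
  then show ?case
    using bounded_linear.continuous_on[OF assms(2)] by simp
next
  case (Suc k)
  show ?case
  proof (rule Ck_on_SucI[OF assms(1)])
    show "((\<lambda>x. h (f x)) has_derivative (\<lambda>v. h (frechet_derivative f (at x) v))) (at x)"
      if "x \<in> S" for x
      by (rule bounded_linear.has_derivative[OF assms(2) Ck_on_Suc_has_derivative[OF Suc.prems that]])
    show "Ck_on k S (\<lambda>x. h (frechet_derivative f (at x) v))" for v
      using Suc by simp
  qed
qed

lemma Ck_on_add:
  assumes "open S" "Ck_on k S f" "Ck_on k S g"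
  shows "Ck_on k S (\<lambda>x. f x + g x)"
  using assms(2,3)
proof (induction k arbitrary: f g)
  case 0
  then show ?case by (simp add: continuous_on_add)
next
  case (Suc k)
  show ?case
  proof (rule Ck_on_SucI[OF assms(1)])
    show "((\<lambda>x. f x + g x) has_derivative
        (\<lambda>v. frechet_derivative f (at x) v + frechet_derivative g (at x) v)) (at x)"
      if "x \<in> S" for x
      using Ck_on_Suc_has_derivative[OF Suc.prems(1) that]
        Ck_on_Suc_has_derivative[OF Suc.prems(2) that]
      by (rule has_derivative_add)
    show "Ck_on k S (\<lambda>x. frechet_derivative f (at x) v + frechet_derivative g (at x) v)" for v
      using Suc by simp
  qed
qed

lemma Ck_on_mult:
  fixes f g :: "'e::euclidean_space \<Rightarrow> real"
  assumes "open S" "Ck_on k S f" "Ck_on k S g"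
  shows "Ck_on k S (\<lambda>x. f x * g x)"
  using assms(2,3)
proof (induction k arbitrary: f g)
  case 0
  then show ?case by (simp add: continuous_on_mult)
next
  case (Suc k)
  show ?case
  proof (rule Ck_on_SucI[OF assms(1)])
    show "((\<lambda>x. f x * g x) has_derivative
        (\<lambda>v. f x * frechet_derivative g (at x) v + frechet_derivative f (at x) v * g x)) (at x)"
      if "x \<in> S" for x
      using Ck_on_Suc_has_derivative[OF Suc.prems(1) that]
        Ck_on_Suc_has_derivative[OF Suc.prems(2) that]
      by (rule has_derivative_mult)
    have "Ck_on k S f" "Ck_on k S g"
      using Suc.prems by (auto intro: Ck_on_SucD)
    then show "Ck_on k S
        (\<lambda>x. f x * frechet_derivative g (at x) v + frechet_derivative f (at x) v * g x)" for v
      using Suc by (intro Ck_on_add[OF assms(1)] Suc.IH) auto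
  qed
qed

text \<open>The derivative of \<open>1/g\<close> is a polynomial in \<open>1/g\<close> and the
  derivative of \<open>g\<close>, so order \<open>k\<close> of \<open>1/g\<close> itself yields
  order \<open>k + 1\<close>.\<close>

lemma Ck_on_inverse:
  fixes g :: "'e::euclidean_space \<Rightarrow> real"
  assumes "open S" "\<And>x. x \<in> S \<Longrightarrow> g x \<noteq> 0" "Ck_on k S g"
  shows "Ck_on k S (\<lambda>x. inverse (g x))"
  using assms(3)
proof (induction k)
  case 0
  then show ?case using assms(2) by (auto intro!: continuous_on_inverse)
next
  case (Suc k)
  show ?case
  proof (rule Ck_on_SucI[OF assms(1)])
    show "((\<lambda>x. inverse (g x)) has_derivative
        (\<lambda>v. - (inverse (g x) * frechet_derivative g (at x) v * inverse (g x)))) (at x)"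
      if "x \<in> S" for x
      using Deriv.has_derivative_inverse[OF assms(2)[OF that] Ck_on_Suc_has_derivative[OF Suc.prems that]] .
    have I: "Ck_on k S (\<lambda>x. inverse (g x))"
      by (rule Suc.IH[OF Ck_on_SucD[OF Suc.prems]])
    show "Ck_on k S (\<lambda>x. - (inverse (g x) * frechet_derivative g (at x) v * inverse (g x)))" for v
      using Suc.prems I
      by (intro Ck_on_bounded_linear[OF assms(1) bounded_linear_minus[OF bounded_linear_ident]]
          Ck_on_mult[OF assms(1)]) auto
  qed
qed

section \<open>Closure properties of smooth functions\<close>

lemma smooth_on_cong:
  assumes "open S" "\<And>x. x \<in> S \<Longrightarrow> f x = g x" "smooth_on S f"
  shows "smooth_on S g"
  using assms unfolding smooth_on_def by (meson Ck_on_cong)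

lemma smooth_on_subset:
  assumes "smooth_on S f" "T \<subseteq> S"
  shows "smooth_on T f"
proof -
  have "Ck_on k S f \<Longrightarrow> Ck_on k T f" for k and f :: "'a \<Rightarrow> 'b"
    using assms(2) by (induction k arbitrary: f) (auto intro: continuous_on_subset)
  with assms(1) show ?thesis unfolding smooth_on_def by blast
qed

lemma smooth_on_const: "smooth_on S (\<lambda>_. c)"
  by (simp add: smooth_on_def Ck_on_const)

lemma smooth_on_bounded_linear:
  "open S \<Longrightarrow> bounded_linear h \<Longrightarrow> smooth_on S f \<Longrightarrow> smooth_on S (\<lambda>x. h (f x))"
  by (simp add: smooth_on_def Ck_on_bounded_linear)

lemma smooth_on_add:
  "open S \<Longrightarrow> smooth_on S f \<Longrightarrow> smooth_on S g \<Longrightarrow> smooth_on S (\<lambda>x. f x + g x)"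
  by (simp add: smooth_on_def Ck_on_add)

lemma smooth_on_uminus:
  "open S \<Longrightarrow> smooth_on S f \<Longrightarrow> smooth_on S (\<lambda>x. - f x)"
  by (rule smooth_on_bounded_linear[OF _ bounded_linear_minus[OF bounded_linear_ident]])

lemma smooth_on_diff:
  assumes "open S" "smooth_on S f" "smooth_on S g"
  shows "smooth_on S (\<lambda>x. f x - g x)"
  using smooth_on_add[OF assms(1,2) smooth_on_uminus[OF assms(1,3)]] by simp

lemma smooth_on_mult:
  fixes f g :: "'e::euclidean_space \<Rightarrow> real"
  shows "open S \<Longrightarrow> smooth_on S f \<Longrightarrow> smooth_on S g \<Longrightarrow> smooth_on S (\<lambda>x. f x * g x)"
  by (simp add: smooth_on_def Ck_on_mult)

lemma smooth_on_power:
  fixes f :: "'e::euclidean_space \<Rightarrow> real"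
  assumes "open S" "smooth_on S f"
  shows "smooth_on S (\<lambda>x. f x ^ n)"
  by (induction n) (auto intro: smooth_on_const smooth_on_mult assms)

lemma smooth_on_divide:
  fixes f g :: "'e::euclidean_space \<Rightarrow> real"
  assumes "open S" "smooth_on S f" "smooth_on S g" "\<And>x. x \<in> S \<Longrightarrow> g x \<noteq> 0"
  shows "smooth_on S (\<lambda>x. f x / g x)"
proof -
  have "smooth_on S (\<lambda>x. inverse (g x))"
    using assms by (simp add: smooth_on_def Ck_on_inverse)
  from smooth_on_mult[OF assms(1,2) this] show ?thesis
    by (simp add: divide_inverse)
qed

lemma smooth_on_has_derivative:
  assumes "smooth_on S f" "x \<in> S"
  shows "(f has_derivative frechet_derivative f (at x)) (at x)"
  using assms unfolding smooth_on_def by (meson Ck_on_Suc_has_derivative)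

lemma smooth_on_frechet_derivative:
  assumes "smooth_on S f"
  shows "smooth_on S (\<lambda>x. frechet_derivative f (at x) v)"
  using assms unfolding smooth_on_def by (metis Ck_on.simps(2))

lemma smooth_on_continuous_on: "smooth_on S f \<Longrightarrow> continuous_on S f"
  unfolding smooth_on_def by (metis Ck_on.simps(1))

text \<open>The mean value theorem is applied twice: along \<open>v\<close> to the difference taken
  in direction \<open>w\<close>, then along \<open>w\<close> to the directional derivative. The
  second difference is symmetric in \<open>v\<close> and \<open>w\<close>, which is what the
  symmetry of second derivatives rests on.\<close>

lemma second_difference_mean_value:
  fixes f :: "'e::euclidean_space \<Rightarrow> real"
  assumes S: "open S" "smooth_on S f" and s: "0 < s"
    and sub: "\<And>a b. \<bar>a\<bar> \<le> s \<Longrightarrow> \<bar>b\<bar> \<le> s \<Longrightarrow> x + a *\<^sub>R v + b *\<^sub>R w \<in> S"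
  obtains a b where "0 < a" "a < s" "0 < b" "b < s"
    "f (x + s *\<^sub>R v + s *\<^sub>R w) - f (x + s *\<^sub>R v) - f (x + s *\<^sub>R w) + f x =
     s * (s * frechet_derivative (\<lambda>y. frechet_derivative f (at y) v) (at (x + a *\<^sub>R v + b *\<^sub>R w)) w)"
proof -
  let ?D = "\<lambda>y. frechet_derivative f (at y) v"
  have dv: "((\<lambda>a. f (x + a *\<^sub>R v + b *\<^sub>R w)) has_real_derivative ?D (x + a *\<^sub>R v + b *\<^sub>R w)) (at a)"
    if "\<bar>a\<bar> \<le> s" "\<bar>b\<bar> \<le> s" for a b
  proof -
    have "((\<lambda>a. x + a *\<^sub>R v + b *\<^sub>R w) has_derivative (\<lambda>h. h *\<^sub>R v)) (at a)"
      by (auto intro!: derivative_eq_intros)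
    from diff_chain_at[OF this smooth_on_has_derivative[OF S(2) sub[OF that]]]
    have "((\<lambda>a. f (x + a *\<^sub>R v + b *\<^sub>R w)) has_derivative
        (\<lambda>h. frechet_derivative f (at (x + a *\<^sub>R v + b *\<^sub>R w)) (h *\<^sub>R v))) (at a)"
      by (simp add: o_def)
    then show ?thesis
      using linear_scale[OF has_derivative_linear[OF smooth_on_has_derivative[OF S(2) sub[OF that]]]]
      by (auto simp: has_field_derivative_def mult.commute elim!: has_derivative_eq_rhs)
  qed
  have dw: "((\<lambda>b. ?D (x + a *\<^sub>R v + b *\<^sub>R w)) has_real_derivative
      frechet_derivative ?D (at (x + a *\<^sub>R v + b *\<^sub>R w)) w) (at b)"
    if "\<bar>a\<bar> \<le> s" "\<bar>b\<bar> \<le> s" for a b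
  proof -
    note D = smooth_on_has_derivative[OF smooth_on_frechet_derivative[OF S(2), of v] sub[OF that]]
    have "((\<lambda>b. x + a *\<^sub>R v + b *\<^sub>R w) has_derivative (\<lambda>h. h *\<^sub>R w)) (at b)"
      by (auto intro!: derivative_eq_intros)
    from diff_chain_at[OF this D]
    show ?thesis
      using linear_scale[OF has_derivative_linear[OF D]]
      by (auto simp: has_field_derivative_def o_def mult.commute elim!: has_derivative_eq_rhs)
  qed
  \<comment> \<open>The summand \<open>0 *\<^sub>R w\<close> gives both terms the shape required by
    \<open>dv\<close>.\<close>
  let ?\<phi> = "\<lambda>a. f (x + a *\<^sub>R v + s *\<^sub>R w) - f (x + a *\<^sub>R v + 0 *\<^sub>R w)"
  have "(?\<phi> has_real_derivative
      ?D (x + a *\<^sub>R v + s *\<^sub>R w) - ?D (x + a *\<^sub>R v + 0 *\<^sub>R w)) (at a)"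
    if "0 \<le> a" "a \<le> s" for a
    using that s by (intro DERIV_diff dv) auto
  from MVT2[OF s this] obtain a where a: "0 < a" "a < s"
    "?\<phi> s - ?\<phi> 0 = (s - 0) * (?D (x + a *\<^sub>R v + s *\<^sub>R w) - ?D (x + a *\<^sub>R v + 0 *\<^sub>R w))"
    by blast
  have "((\<lambda>b. ?D (x + a *\<^sub>R v + b *\<^sub>R w)) has_real_derivative
      frechet_derivative ?D (at (x + a *\<^sub>R v + b *\<^sub>R w)) w) (at b)"
    if "0 \<le> b" "b \<le> s" for b
    using that a by (intro dw) auto
  from MVT2[OF s this] obtain b where b: "0 < b" "b < s"
    "?D (x + a *\<^sub>R v + s *\<^sub>R w) - ?D (x + a *\<^sub>R v + 0 *\<^sub>R w) =
     (s - 0) * frechet_derivative ?D (at (x + a *\<^sub>R v + b *\<^sub>R w)) w"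
    by blast
  show thesis
    by (rule that[OF a(1,2) b(1,2)]) (use a(3) b(3) in \<open>simp add: algebra_simps\<close>)
qed

text \<open>Schwarz's theorem: at every small scale the two mixed derivatives agree at suitable
  points of the parallelogram spanned at \<open>x\<close>; continuity carries the equality to
  \<open>x\<close> as the scale tends to 0.\<close>

lemma frechet_derivative_commute:
  fixes f :: "'e::euclidean_space \<Rightarrow> real"
  assumes S: "open S" "smooth_on S f" "x \<in> S"
  shows "frechet_derivative (\<lambda>y. frechet_derivative f (at y) v) (at x) w =
         frechet_derivative (\<lambda>y. frechet_derivative f (at y) w) (at x) v"
proof -
  let ?A = "\<lambda>v w y. frechet_derivative (\<lambda>y. frechet_derivative f (at y) v) (at y) w"
  obtain e where e: "0 < e" "ball x e \<subseteq> S"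
    using S by (meson open_contains_ball)
  \<comment> \<open>Scales below \<open>\<delta>\<close> keep the parallelogram inside the ball. The
    summand 1 keeps the denominator positive when \<open>v\<close> and \<open>w\<close> are
    0.\<close>
  define \<delta> where "\<delta> = e / (norm v + norm w + 1)"
  have pos: "0 < norm v + norm w + 1"
    by (smt (verit) norm_ge_zero)
  have \<delta>: "0 < \<delta>" using e pos by (simp add: \<delta>_def)
  have near: "dist (x + a *\<^sub>R v + b *\<^sub>R w) x \<le> s * (norm v + norm w)"
    if "\<bar>a\<bar> \<le> s" "\<bar>b\<bar> \<le> s" for a b s
  proof -
    have "norm (a *\<^sub>R v + b *\<^sub>R w) \<le> \<bar>a\<bar> * norm v + \<bar>b\<bar> * norm w"
      by (metis norm_scaleR norm_triangle_ineq)
    also have "\<dots> \<le> s * norm v + s * norm w"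
      using that by (intro add_mono mult_right_mono) auto
    finally show ?thesis by (simp add: dist_norm algebra_simps)
  qed
  have sub: "x + a *\<^sub>R v + b *\<^sub>R w \<in> S" if "s < \<delta>" "\<bar>a\<bar> \<le> s" "\<bar>b\<bar> \<le> s" for a b s
  proof -
    have "s * (norm v + norm w) \<le> s * (norm v + norm w + 1)"
      using that by (intro mult_left_mono) auto
    also have "\<dots> < e" using that pos by (simp add: \<delta>_def pos_less_divide_eq)
    finally show ?thesis using near[OF that(2,3)] e(2) by (auto simp: dist_commute)
  qed
  define s where "s n = \<delta> / 2 * inverse (real (Suc n))" for n
  have s: "0 < s n" "s n < \<delta>" for n
  proof -
    have "\<delta> / 2 * inverse (real (Suc n)) \<le> \<delta> / 2 * 1"
      using \<delta> by (intro mult_left_mono) (auto simp: field_simps)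
    then show "0 < s n" "s n < \<delta>" using \<delta> by (simp_all add: s_def)
  qed
  have s0: "s \<longlonglongrightarrow> 0"
    unfolding s_def by (rule tendsto_mult_right_zero[OF LIMSEQ_inverse_real_of_nat])
  have lim: "(\<lambda>n. ?A p q (z n)) \<longlonglongrightarrow> ?A p q x"
    if "\<And>n. dist (z n) x \<le> s n * (norm v + norm w)" for p q z
  proof -
    have h: "(\<lambda>n. s n * (norm v + norm w)) \<longlonglongrightarrow> 0"
      by (rule tendsto_mult_left_zero[OF s0])
    have "(\<lambda>n. dist (z n) x) \<longlonglongrightarrow> 0"
      by (rule tendsto_sandwich[OF _ _ tendsto_const h]) (simp_all add: that)
    then have "z \<longlonglongrightarrow> x" by (subst tendsto_dist_iff)
    moreover have "isCont (?A p q) x"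
      using smooth_on_continuous_on[OF smooth_on_frechet_derivative[OF
            smooth_on_frechet_derivative[OF S(2)]], of p q] S(1,3)
      by (simp add: continuous_on_eq_continuous_at)
    ultimately show ?thesis by (rule isCont_tendsto_compose[rotated])
  qed
  have "\<exists>z z'. dist z x \<le> s n * (norm v + norm w) \<and> dist z' x \<le> s n * (norm v + norm w) \<and>
      ?A v w z = ?A w v z'" for n
  proof -
    have sub0: "x + a *\<^sub>R v + b *\<^sub>R w \<in> S" if "\<bar>a\<bar> \<le> s n" "\<bar>b\<bar> \<le> s n" for a b
      by (rule sub[OF s(2) that])
    obtain a b where ab: "0 < a" "a < s n" "0 < b" "b < s n"
      "f (x + s n *\<^sub>R v + s n *\<^sub>R w) - f (x + s n *\<^sub>R v) - f (x + s n *\<^sub>R w) + f x =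
       s n * (s n * ?A v w (x + a *\<^sub>R v + b *\<^sub>R w))"
      using second_difference_mean_value[OF S(1,2) s(1) sub0] by blast
    \<comment> \<open>Exchanging \<open>v\<close> and \<open>w\<close> leaves the second difference
      unchanged, so the second use of the mean value lemma evaluates the same number.\<close>
    have swap: "x + c *\<^sub>R w + d *\<^sub>R v = x + d *\<^sub>R v + c *\<^sub>R w" for c d
      by simp
    have sub': "x + c *\<^sub>R w + d *\<^sub>R v \<in> S" if "\<bar>c\<bar> \<le> s n" "\<bar>d\<bar> \<le> s n" for c d
      unfolding swap by (rule sub[OF s(2) that(2,1)])
    obtain c d where cd: "0 < c" "c < s n" "0 < d" "d < s n"
      "f (x + s n *\<^sub>R w + s n *\<^sub>R v) - f (x + s n *\<^sub>R w) - f (x + s n *\<^sub>R v) + f x =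
       s n * (s n * ?A w v (x + c *\<^sub>R w + d *\<^sub>R v))"
      using second_difference_mean_value[OF S(1,2) s(1) sub'] by blast
    have "s n * (s n * ?A v w (x + a *\<^sub>R v + b *\<^sub>R w)) =
        s n * (s n * ?A w v (x + d *\<^sub>R v + c *\<^sub>R w))"
      using ab(5) cd(5) unfolding swap by linarith
    then have "?A v w (x + a *\<^sub>R v + b *\<^sub>R w) = ?A w v (x + d *\<^sub>R v + c *\<^sub>R w)"
      using s(1)[of n] by simp
    moreover have "dist (x + a *\<^sub>R v + b *\<^sub>R w) x \<le> s n * (norm v + norm w)"
      "dist (x + d *\<^sub>R v + c *\<^sub>R w) x \<le> s n * (norm v + norm w)"
      using ab(1-4) cd(1-4) by (auto intro!: near)
    ultimately show ?thesis by blast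
  qed
  then have "\<forall>n. \<exists>z z'. dist z x \<le> s n * (norm v + norm w) \<and>
      dist z' x \<le> s n * (norm v + norm w) \<and> ?A v w z = ?A w v z'"
    by blast
  from choice[OF this] obtain z where "\<forall>n. \<exists>z'. dist (z n) x \<le> s n * (norm v + norm w) \<and>
      dist z' x \<le> s n * (norm v + norm w) \<and> ?A v w (z n) = ?A w v z'"
    by blast
  from choice[OF this] obtain z' where z: "\<And>n. dist (z n) x \<le> s n * (norm v + norm w)"
    "\<And>n. dist (z' n) x \<le> s n * (norm v + norm w)" "\<And>n. ?A v w (z n) = ?A w v (z' n)"
    by blast
  show ?thesis
    using lim[OF z(1), of v w] lim[OF z(2), of w v] unfolding z(3) by (rule LIMSEQ_unique)
qed

section \<open>Derivatives in local coordinates of the plane\<close>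

definition deriv_along ::
  "('e::euclidean_space \<Rightarrow> 'e) \<Rightarrow> ('e \<Rightarrow> 'f::real_normed_vector) \<Rightarrow> 'e \<Rightarrow> 'f" where
  "deriv_along V u z = frechet_derivative u (at z) (V z)"

lemma deriv_along_const [simp]: "deriv_along V (\<lambda>_. c) = (\<lambda>_. 0)"
  by (simp add: deriv_along_def fun_eq_iff)

lemma deriv_along_eqI: "(u has_derivative u') (at z) \<Longrightarrow> deriv_along V u z = u' (V z)"
  by (simp add: deriv_along_def flip: frechet_derivative_at)

text \<open>Locality of the derivative. This is how identities known only on an open set get
  differentiated.\<close>

lemma deriv_along_cong:
  assumes "open S" "z \<in> S" "\<And>x. x \<in> S \<Longrightarrow> u x = v x" "smooth_on S u"
  shows "deriv_along V u z = deriv_along V v z"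
  using has_derivative_transform_within_open[OF smooth_on_has_derivative[OF assms(4,2)] assms(1,2,3)]
  by (simp add: deriv_along_eqI[of v] deriv_along_def[of V u])

context
  fixes S :: "'e::euclidean_space set" and u v :: "'e \<Rightarrow> real" and z :: 'e and V :: "'e \<Rightarrow> 'e"
  assumes S: "z \<in> S" "smooth_on S u" "smooth_on S v"
begin

lemma deriv_along_add: "deriv_along V (\<lambda>x. u x + v x) z = deriv_along V u z + deriv_along V v z"
  using deriv_along_eqI[OF has_derivative_add[OF smooth_on_has_derivative[OF S(2,1)]
        smooth_on_has_derivative[OF S(3,1)]]]
  by (simp add: deriv_along_def)

lemma deriv_along_diff: "deriv_along V (\<lambda>x. u x - v x) z = deriv_along V u z - deriv_along V v z"
  using deriv_along_eqI[OF has_derivative_diff[OF smooth_on_has_derivative[OF S(2,1)]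
        smooth_on_has_derivative[OF S(3,1)]]]
  by (simp add: deriv_along_def)

lemma deriv_along_mult:
  "deriv_along V (\<lambda>x. u x * v x) z = u z * deriv_along V v z + deriv_along V u z * v z"
  using deriv_along_eqI[OF has_derivative_mult[OF smooth_on_has_derivative[OF S(2,1)]
        smooth_on_has_derivative[OF S(3,1)]]]
  by (simp add: deriv_along_def)

lemma deriv_along_power2: "deriv_along V (\<lambda>x. (u x)\<^sup>2) z = 2 * u z * deriv_along V u z"
  using deriv_along_eqI[OF has_derivative_mult[OF smooth_on_has_derivative[OF S(2,1)]
        smooth_on_has_derivative[OF S(2,1)]]]
  by (simp add: deriv_along_def power2_eq_square)

end

text \<open>The functions \<open>x\<close> and \<open>y\<close> act as local coordinates through
  their coordinate fields alone: a nonzero Jacobian determines the fields dual to the differentials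
  of \<open>x\<close> and \<open>y\<close>, and all computations on \<open>U\<close> use these
  fields.\<close>

locale planar_frame =
  fixes U :: "(real^2) set" and x y :: "real^2 \<Rightarrow> real"
  assumes open_U: "open U" and smooth_x: "smooth_on U x" and smooth_y: "smooth_on U y"
    and jacobian_nonzero:
      "\<And>z. z \<in> U \<Longrightarrow> frechet_derivative x (at z) (axis 1 1) * frechet_derivative y (at z) (axis 2 1) -
        frechet_derivative x (at z) (axis 2 1) * frechet_derivative y (at z) (axis 1 1) \<noteq> 0"
begin

abbreviation partial :: "2 \<Rightarrow> (real^2 \<Rightarrow> real) \<Rightarrow> real^2 \<Rightarrow> real" where
  "partial i u z \<equiv> frechet_derivative u (at z) (axis i 1)"

definition jacobian :: "real^2 \<Rightarrow> real" where
  "jacobian z = partial 1 x z * partial 2 y z - partial 2 x z * partial 1 y z"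

text \<open>\<open>V 1, V 2\<close> are the coordinate fields of the local coordinates \<open>x, y\<close>, so that \<open>d 1, d 2\<close> are
  the partial derivatives in these coordinates.\<close>

definition V :: "2 \<Rightarrow> real^2 \<Rightarrow> real^2" where
  "V k z = (1 / jacobian z) *\<^sub>R
     (if k = 1 then partial 2 y z *\<^sub>R axis 1 1 - partial 1 y z *\<^sub>R axis 2 1
      else partial 1 x z *\<^sub>R axis 2 1 - partial 2 x z *\<^sub>R axis 1 1)"

abbreviation d :: "2 \<Rightarrow> (real^2 \<Rightarrow> real) \<Rightarrow> real^2 \<Rightarrow> real" where
  "d k \<equiv> deriv_along (V k)"

lemma jacobian_neq_0: "z \<in> U \<Longrightarrow> jacobian z \<noteq> 0"
  using jacobian_nonzero by (simp add: jacobian_def)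

lemma smooth_jacobian: "smooth_on U jacobian"
  unfolding jacobian_def[abs_def]
  by (intro smooth_on_diff smooth_on_mult smooth_on_frechet_derivative smooth_x smooth_y open_U)

lemma linear_derivative: "smooth_on U u \<Longrightarrow> z \<in> U \<Longrightarrow> linear (frechet_derivative u (at z))"
  using smooth_on_has_derivative has_derivative_linear by blast

text \<open>Cramer's rule, in a form from which smoothness of \<open>d k u\<close> can be read
  off.\<close>

lemma d_eq:
  fixes u :: "real^2 \<Rightarrow> real"
  assumes "smooth_on U u" "z \<in> U"
  shows "d k u z = (if k = 1 then partial 1 u z * partial 2 y z - partial 2 u z * partial 1 y z
      else partial 1 x z * partial 2 u z - partial 2 x z * partial 1 u z) / jacobian z"
  using linear_derivative[OF assms]
  by (simp add: deriv_along_def V_def linear_scale linear_diff diff_divide_distrib algebra_simps)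

lemma smooth_d [simp]:
  assumes "smooth_on U u" shows "smooth_on U (d k u)"
proof -
  have "smooth_on U (\<lambda>z. (if k = 1 then partial 1 u z * partial 2 y z - partial 2 u z * partial 1 y z
      else partial 1 x z * partial 2 u z - partial 2 x z * partial 1 u z) / jacobian z)"
    by (cases "k = 1") (simp_all add: smooth_on_divide smooth_on_diff smooth_on_mult
        smooth_on_frechet_derivative smooth_x smooth_y open_U assms smooth_jacobian jacobian_neq_0)
  then show ?thesis
    by (rule smooth_on_cong[OF open_U, rotated]) (simp add: d_eq[OF assms])
qed

lemma d_x: "z \<in> U \<Longrightarrow> d k x z = (if k = 1 then 1 else 0)"
  using jacobian_neq_0[of z] by (simp add: d_eq[OF smooth_x] jacobian_def)

lemma d_y: "z \<in> U \<Longrightarrow> d k y z = (if k = 1 then 0 else 1)"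
  using jacobian_neq_0[of z] by (simp add: d_eq[OF smooth_y] jacobian_def)

lemma vector_decomp:
  assumes "z \<in> U"
  shows "v = frechet_derivative x (at z) v *\<^sub>R V 1 z + frechet_derivative y (at z) v *\<^sub>R V 2 z"
proof -
  have v: "v = (v $ 1) *\<^sub>R axis 1 1 + (v $ 2) *\<^sub>R axis 2 1"
    by (simp add: vec_eq_iff forall_2 axis_def)
  have "frechet_derivative u (at z) v = v $ 1 * partial 1 u z + v $ 2 * partial 2 u z"
    if "smooth_on U u" for u :: "real^2 \<Rightarrow> real"
    using linear_derivative[OF that assms] by (subst v) (simp add: linear_add linear_scale)
  note D = this[OF smooth_x] this[OF smooth_y]
  define a where "a i = partial i x z" for i
  define b where "b i = partial i y z" for i
  note J = jacobian_neq_0[OF assms]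
  \<comment> \<open>Multiplying by the Jacobian clears the denominator of \<open>V\<close>, so that
    the claim becomes a polynomial identity in each component.\<close>
  have V: "jacobian z *\<^sub>R V 1 z = b 2 *\<^sub>R axis 1 1 - b 1 *\<^sub>R axis 2 1"
    "jacobian z *\<^sub>R V 2 z = a 1 *\<^sub>R axis 2 1 - a 2 *\<^sub>R axis 1 1"
    using J by (simp_all add: V_def a_def b_def)
  have "jacobian z *\<^sub>R (frechet_derivative x (at z) v *\<^sub>R V 1 z + frechet_derivative y (at z) v *\<^sub>R V 2 z) =
      (v $ 1 * a 1 + v $ 2 * a 2) *\<^sub>R (jacobian z *\<^sub>R V 1 z) +
      (v $ 1 * b 1 + v $ 2 * b 2) *\<^sub>R (jacobian z *\<^sub>R V 2 z)"
    by (simp add: D scaleR_add_right a_def b_def mult.commute)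
  also have "\<dots> = jacobian z *\<^sub>R v"
    unfolding V unfolding jacobian_def a_def[symmetric] b_def[symmetric]
    by (simp add: vec_eq_iff forall_2 axis_eq_axis axis_def algebra_simps)
  finally show ?thesis using J by simp
qed

lemma derivative_decomp:
  fixes u :: "real^2 \<Rightarrow> real"
  assumes "smooth_on U u" "z \<in> U"
  shows "frechet_derivative u (at z) v =
    frechet_derivative x (at z) v * d 1 u z + frechet_derivative y (at z) v * d 2 u z"
  using linear_derivative[OF assms]
  by (subst vector_decomp[OF assms(2), of v]) (simp add: linear_add linear_scale deriv_along_def)

text \<open>The chain rule \<open>derivative_decomp\<close> differentiated once more. Second
  derivatives of \<open>x\<close> and \<open>y\<close> enter because the coordinates may be
  nonlinear.\<close>

lemma second_derivative_decomp:
  fixes u :: "real^2 \<Rightarrow> real"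
  assumes u: "smooth_on U u" and z: "z \<in> U"
  shows "frechet_derivative (\<lambda>z. frechet_derivative u (at z) v) (at z) w =
    frechet_derivative (\<lambda>z. frechet_derivative x (at z) v) (at z) w * d 1 u z +
    frechet_derivative x (at z) v * frechet_derivative (d 1 u) (at z) w +
    frechet_derivative (\<lambda>z. frechet_derivative y (at z) v) (at z) w * d 2 u z +
    frechet_derivative y (at z) v * frechet_derivative (d 2 u) (at z) w"
proof -
  \<comment> \<open>A fixed direction is treated as a constant field, which makes the product rules
    for \<open>deriv_along\<close> available.\<close>
  let ?D = "deriv_along (\<lambda>_. w)"
  let ?x = "\<lambda>z. frechet_derivative x (at z) v" and ?y = "\<lambda>z. frechet_derivative y (at z) v"
  note s = smooth_on_frechet_derivative[OF smooth_x, of v]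
    smooth_on_frechet_derivative[OF smooth_y, of v] smooth_d[OF u]
  have "?D (\<lambda>z. frechet_derivative u (at z) v) z = ?D (\<lambda>z. ?x z * d 1 u z + ?y z * d 2 u z) z"
    by (rule deriv_along_cong[OF open_U z _ smooth_on_frechet_derivative[OF u]])
      (rule derivative_decomp[OF u])
  also have "\<dots> = ?x z * ?D (d 1 u) z + ?D ?x z * d 1 u z + (?y z * ?D (d 2 u) z + ?D ?y z * d 2 u z)"
    using s by (simp add: deriv_along_add[OF z] deriv_along_mult[OF z] smooth_on_mult open_U)
  finally show ?thesis by (simp add: deriv_along_def)
qed

text \<open>Coordinate fields commute. Antisymmetrising the second derivatives of \<open>u\<close>
  along the two axes cancels the terms with second derivatives of \<open>x\<close> and
  \<open>y\<close>; what is left is the Jacobian times the commutator.\<close>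

lemma d_commute_12:
  assumes u: "smooth_on U u" and z: "z \<in> U"
  shows "d 1 (d 2 u) z = d 2 (d 1 u) z"
proof -
  note s = frechet_derivative_commute[OF open_U _ z, of _ "axis 1 1" "axis 2 1"]
  have "jacobian z * (d 2 (d 1 u) z - d 1 (d 2 u) z) = 0"
    using s[OF u] s[OF smooth_x] s[OF smooth_y]
    unfolding second_derivative_decomp[OF u z] derivative_decomp[OF smooth_d[OF u] z] jacobian_def
    by (simp add: algebra_simps)
  then show ?thesis using jacobian_neq_0[OF z] by simp
qed

lemma d_commute:
  assumes "smooth_on U u" "z \<in> U"
  shows "d k (d l u) z = d l (d k u) z"
  using d_commute_12[OF assms] exhaust_2[of k] exhaust_2[of l] by auto

text \<open>The field is frozen to its value \<open>v\<close> at \<open>z\<close>. A negative second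
  derivative would make the slope along the straight line in direction \<open>v\<close> negative
  just after \<open>z\<close>, and the mean value theorem would give a smaller value of
  \<open>u\<close>.\<close>

lemma second_derivative_test:
  fixes u :: "real^2 \<Rightarrow> real"
  assumes u: "smooth_on U u" and z: "z \<in> U" and min: "\<And>z'. z' \<in> U \<Longrightarrow> u z \<le> u z'"
    and crit: "d 1 u z = 0" "d 2 u z = 0"
  shows "0 \<le> d k (d k u) z"
proof (rule ccontr)
  assume neg: "\<not> ?thesis"
  define v where "v = V k z"
  let ?D = "\<lambda>z. frechet_derivative u (at z) v"
  \<comment> \<open>At a critical point the first-order terms of
    \<open>second_derivative_decomp\<close> drop out, so freezing the field does not change the
    second derivative.\<close>
  have "frechet_derivative ?D (at z) v = d k (d k u) z"
    unfolding second_derivative_decomp[OF u z] using exhaust_2[of k] d_x[OF z] d_y[OF z] crit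
    by (auto simp: deriv_along_def v_def)
  with neg have neg: "frechet_derivative ?D (at z) v < 0" by simp
  have line: "((\<lambda>t. f (z + t *\<^sub>R v)) has_real_derivative frechet_derivative f (at (z + t *\<^sub>R v)) v) (at t)"
    if "smooth_on U f" "z + t *\<^sub>R v \<in> U" for f :: "real^2 \<Rightarrow> real" and t
  proof -
    note D = smooth_on_has_derivative[OF that]
    have "((\<lambda>t. z + t *\<^sub>R v) has_derivative (\<lambda>h. h *\<^sub>R v)) (at t)"
      by (auto intro!: derivative_eq_intros)
    from diff_chain_at[OF this D] show ?thesis
      using linear_scale[OF has_derivative_linear[OF D]]
      by (auto simp: has_field_derivative_def o_def mult.commute elim!: has_derivative_eq_rhs)
  qed
  have z0: "z + 0 *\<^sub>R v \<in> U" using z by simp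
  obtain \<delta> where \<delta>: "0 < \<delta>" "\<And>h. 0 < h \<Longrightarrow> h < \<delta> \<Longrightarrow> ?D (z + (0 + h) *\<^sub>R v) < ?D (z + 0 *\<^sub>R v)"
    using DERIV_neg_dec_right[OF line[OF smooth_on_frechet_derivative[OF u] z0]] neg by auto
  have crit0: "?D z = 0"
    using derivative_decomp[OF u z, of v] crit by simp
  have "open ((\<lambda>t. z + t *\<^sub>R v) -` U)"
    by (intro continuous_open_vimage open_U) (auto intro!: continuous_intros)
  moreover have "0 \<in> (\<lambda>t. z + t *\<^sub>R v) -` U" using z0 by simp
  ultimately obtain e where e: "0 < e" "ball 0 e \<subseteq> (\<lambda>t. z + t *\<^sub>R v) -` U"
    unfolding open_contains_ball by blast
  define s where "s = min \<delta> e / 2"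
  have s: "0 < s" "s < \<delta>" "s < e" using \<delta>(1) e(1) by (auto simp: s_def)
  have inU: "z + t *\<^sub>R v \<in> U" if "0 \<le> t" "t \<le> s" for t
    using that s e(2) by (auto simp: subset_iff dist_norm)
  obtain t where t: "0 < t" "t < s" "u (z + s *\<^sub>R v) - u (z + 0 *\<^sub>R v) = (s - 0) * ?D (z + t *\<^sub>R v)"
    using MVT2[OF s(1), of "\<lambda>t. u (z + t *\<^sub>R v)" "\<lambda>t. ?D (z + t *\<^sub>R v)"] line[OF u inU] by blast
  have "?D (z + t *\<^sub>R v) < 0"
    using \<delta>(2)[of t] t s crit0 by simp
  from mult_pos_neg[OF s(1) this] have "u (z + s *\<^sub>R v) < u z"
    using t(3) by simp
  with min[OF inU[of s]] s(1) show False by simp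
qed

end

section \<open>Graphical self-shrinkers with constant norm of the second fundamental form\<close>

text \<open>Both equations are cleared of denominators. The second one is
  \<open>|B|\<^sup>2 = |H|\<^sup>2 - 2 K\<close>, with \<open>K\<close> the Gauss curvature and
  \<open>|H|\<close> eliminated by the shrinker equation, so second derivatives of \<open>f\<close>
  enter it only through the Hessian determinant.\<close>

locale shrinker_graph = planar_frame +
  fixes f :: "real^2 \<Rightarrow> real" and b :: real
  assumes smooth_f: "smooth_on U f"
    and shrinker_equation: "z \<in> U \<Longrightarrow>
      (1 + (d 2 f z)\<^sup>2) * d 1 (d 1 f) z - 2 * (d 1 f z * (d 2 f z * d 1 (d 2 f) z)) +
      (1 + (d 1 f z)\<^sup>2) * d 2 (d 2 f) z +
      1/2 * ((1 + (d 1 f z)\<^sup>2 + (d 2 f z)\<^sup>2) * (f z - x z * d 1 f z - y z * d 2 f z)) = 0"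
    and constant_norm_equation: "z \<in> U \<Longrightarrow>
      1/4 * ((1 + (d 1 f z)\<^sup>2 + (d 2 f z)\<^sup>2) * (f z - x z * d 1 f z - y z * d 2 f z)\<^sup>2) -
      2 * (d 1 (d 1 f) z * d 2 (d 2 f) z - (d 1 (d 2 f) z)\<^sup>2) -
      b * (1 + (d 1 f z)\<^sup>2 + (d 2 f z)\<^sup>2)\<^sup>2 = 0"
begin

lemmas smooth_rules = smooth_x smooth_y smooth_f smooth_d smooth_on_const smooth_on_add[OF open_U]
  smooth_on_diff[OF open_U] smooth_on_mult[OF open_U] smooth_on_power[OF open_U]
  smooth_on_uminus[OF open_U]

lemma smooth_on_divide_const [simp]:
  fixes u :: "real^2 \<Rightarrow> real"
  shows "smooth_on U u \<Longrightarrow> smooth_on U (\<lambda>z. u z / c)"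
  by (rule smooth_on_bounded_linear[OF open_U bounded_linear_divide])

lemma d_rules:
  fixes u v :: "real^2 \<Rightarrow> real"
  assumes "z \<in> U" "smooth_on U u"
  shows "smooth_on U v \<Longrightarrow> d k (\<lambda>z. u z + v z) z = d k u z + d k v z"
    "smooth_on U v \<Longrightarrow> d k (\<lambda>z. u z - v z) z = d k u z - d k v z"
    "smooth_on U v \<Longrightarrow> d k (\<lambda>z. u z * v z) z = u z * d k v z + d k u z * v z"
    "d k (\<lambda>z. (u z)\<^sup>2) z = 2 * u z * d k u z"
    "d k (\<lambda>z. - u z) z = - d k u z"
    "d k (\<lambda>z. u z / c) z = d k u z / c"
  using deriv_along_add[OF assms] deriv_along_diff[OF assms] deriv_along_mult[OF assms]
    deriv_along_power2[OF assms assms(2)] deriv_along_diff[OF assms(1) smooth_on_const[of _ 0] assms(2)]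
    deriv_along_mult[OF assms smooth_on_const[of _ "1/c"]] by auto

lemma d_zero:
  assumes "z \<in> U" "smooth_on U u" "\<And>z. z \<in> U \<Longrightarrow> u z = 0"
  shows "d k u z = 0"
  using deriv_along_cong[OF open_U assms(1,3,2)] by simp

text \<open>The inner product of the position vector with the unnormalised upward normal: the
  support function up to scaling.\<close>

definition w :: "real^2 \<Rightarrow> real" where
  "w z = f z - x z * d 1 f z - y z * d 2 f z"

text \<open>The squared length of that normal, which is also the determinant of the induced
  metric.\<close>

definition D :: "real^2 \<Rightarrow> real" where
  "D z = 1 + (d 1 f z)\<^sup>2 + (d 2 f z)\<^sup>2"

lemma smooth_w: "smooth_on U w" and smooth_D: "smooth_on U D"
  unfolding w_def[abs_def] D_def[abs_def] by (simp_all add: smooth_rules)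

text \<open>The first derivatives of \<open>f\<close> cancel, so \<open>w\<close> is critical
  wherever \<open>x\<close> and \<open>y\<close> vanish.\<close>

lemma d_w: "z \<in> U \<Longrightarrow> d k w z = - (x z * d k (d 1 f) z) - y z * d k (d 2 f) z"
  unfolding w_def[abs_def] using exhaust_2[of k]
  by (auto simp: d_rules smooth_rules d_x d_y)

lemma d_D: "z \<in> U \<Longrightarrow> d k D z = 2 * d 1 f z * d k (d 1 f) z + 2 * d 2 f z * d k (d 2 f) z"
  unfolding D_def[abs_def] by (simp add: d_rules smooth_rules)

lemma dd_w:
  assumes "z \<in> U" "x z = 0" "y z = 0"
  shows "d l (d k w) z = - d k (d l f) z"
proof -
  have "d l (d k w) z = d l (\<lambda>z. - (x z * d k (d 1 f) z) - y z * d k (d 2 f) z) z"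
    by (rule deriv_along_cong[OF open_U assms(1)]) (simp_all add: d_w smooth_w smooth_rules)
  also have "\<dots> = - d k (d l f) z"
    using exhaust_2[of l] assms by (auto simp: d_rules smooth_rules d_x d_y)
  finally show ?thesis .
qed

lemma dd_D:
  assumes "z \<in> U" "d 1 f z = 0" "d 2 f z = 0"
  shows "d l (d k D) z = 2 * (d l (d 1 f) z * d k (d 1 f) z + d l (d 2 f) z * d k (d 2 f) z)"
proof -
  have "d l (d k D) z = d l (\<lambda>z. 2 * d 1 f z * d k (d 1 f) z + 2 * d 2 f z * d k (d 2 f) z) z"
    by (rule deriv_along_cong[OF open_U assms(1)]) (simp_all add: d_D smooth_D smooth_rules)
  also have "\<dots> = 2 * (d l (d 1 f) z * d k (d 1 f) z + d l (d 2 f) z * d k (d 2 f) z)"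
    using assms by (simp add: d_rules smooth_rules)
  finally show ?thesis .
qed

text \<open>The derivative of a function vanishing on all of \<open>U\<close>. It is stated at a
  general point, with products left unexpanded, because it is differentiated again.\<close>

lemma d_shrinker_equation:
  assumes "z \<in> U"
  shows "2 * (d 2 f z * (d k (d 2 f) z * d 1 (d 1 f) z)) + (1 + (d 2 f z)\<^sup>2) * d k (d 1 (d 1 f)) z -
    2 * (d 1 f z * (d 2 f z * d k (d 1 (d 2 f)) z + d k (d 2 f) z * d 1 (d 2 f) z) +
         d k (d 1 f) z * (d 2 f z * d 1 (d 2 f) z)) +
    2 * (d 1 f z * (d k (d 1 f) z * d 2 (d 2 f) z)) + (1 + (d 1 f z)\<^sup>2) * d k (d 2 (d 2 f)) z +
    1/2 * (D z * d k w z + d k D z * w z) = 0" (is "?L = 0")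
proof -
  have "?L = d k (\<lambda>z. (1 + (d 2 f z)\<^sup>2) * d 1 (d 1 f) z -
      2 * (d 1 f z * (d 2 f z * d 1 (d 2 f) z)) + (1 + (d 1 f z)\<^sup>2) * d 2 (d 2 f) z +
      1/2 * (D z * w z)) z"
    using assms by (simp add: d_rules smooth_rules smooth_w smooth_D)
  also have "\<dots> = 0"
    by (rule d_zero[OF assms])
      (simp add: smooth_rules smooth_w smooth_D, simp only: w_def D_def shrinker_equation)
  finally show ?thesis .
qed

lemma d_constant_norm_equation:
  assumes "z \<in> U"
  shows "1/4 * (D z * (2 * (w z * d k w z)) + d k D z * (w z)\<^sup>2) -
    2 * (d 1 (d 1 f) z * d k (d 2 (d 2 f)) z + d k (d 1 (d 1 f)) z * d 2 (d 2 f) z -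
         2 * (d 1 (d 2 f) z * d k (d 1 (d 2 f)) z)) -
    b * (2 * (D z * d k D z)) = 0" (is "?L = 0")
proof -
  have "?L = d k (\<lambda>z. 1/4 * (D z * (w z)\<^sup>2) -
      2 * (d 1 (d 1 f) z * d 2 (d 2 f) z - (d 1 (d 2 f) z)\<^sup>2) - b * (D z)\<^sup>2) z"
    using assms by (simp add: d_rules smooth_rules smooth_w smooth_D)
  also have "\<dots> = 0"
    by (rule d_zero[OF assms])
      (simp add: smooth_rules smooth_w smooth_D, simp only: w_def D_def constant_norm_equation)
  finally show ?thesis .
qed

section \<open>Second derivatives of both equations at a point with normal position vector\<close>

context
  fixes p
  assumes p: "p \<in> U" "x p = 0" "y p = 0" "d 1 f p = 0" "d 2 f p = 0"
begin

lemma base_values: "w p = f p" "D p = 1" "d k w p = 0" "d k D p = 0"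
  using p by (simp_all add: w_def D_def d_w d_D)

text \<open>The first derivatives of \<open>f\<close>, \<open>w\<close> and \<open>D\<close> vanish
  at \<open>p\<close>, so a product containing one of them as a factor survives only where the new
  derivative hits that factor.\<close>

lemma dd_shrinker_equation:
  "2 * (d l (d 2 f) p * d k (d 2 f) p * d 1 (d 1 f) p) + d l (d k (d 1 (d 1 f))) p -
   2 * ((d l (d 1 f) p * d k (d 2 f) p + d k (d 1 f) p * d l (d 2 f) p) * d 1 (d 2 f) p) +
   2 * (d l (d 1 f) p * d k (d 1 f) p * d 2 (d 2 f) p) + d l (d k (d 2 (d 2 f))) p +
   1/2 * (d l (d k w) p + d l (d k D) p * f p) = 0"
proof -
  have "d l (\<lambda>z. 2 * (d 2 f z * (d k (d 2 f) z * d 1 (d 1 f) z)) + (1 + (d 2 f z)\<^sup>2) * d k (d 1 (d 1 f)) z -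
    2 * (d 1 f z * (d 2 f z * d k (d 1 (d 2 f)) z + d k (d 2 f) z * d 1 (d 2 f) z) +
    d k (d 1 f) z * (d 2 f z * d 1 (d 2 f) z)) +
    2 * (d 1 f z * (d k (d 1 f) z * d 2 (d 2 f) z)) + (1 + (d 1 f z)\<^sup>2) * d k (d 2 (d 2 f)) z +
    1/2 * (D z * d k w z + d k D z * w z)) p = 0"
    by (rule d_zero[OF p(1) _ d_shrinker_equation]) (simp_all add: smooth_rules smooth_w smooth_D)
  then show ?thesis
    using p base_values
    by (simp add: d_rules smooth_rules smooth_w smooth_D) (simp add: algebra_simps)
qed

lemma dd_constant_norm_equation:
  "1/4 * (2 * (f p * d l (d k w) p) + d l (d k D) p * (f p)\<^sup>2) -
   2 * (d 1 (d 1 f) p * d l (d k (d 2 (d 2 f))) p + d l (d k (d 1 (d 1 f))) p * d 2 (d 2 f) p +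
     d l (d 1 (d 1 f)) p * d k (d 2 (d 2 f)) p + d k (d 1 (d 1 f)) p * d l (d 2 (d 2 f)) p -
     2 * (d 1 (d 2 f) p * d l (d k (d 1 (d 2 f))) p + d l (d 1 (d 2 f)) p * d k (d 1 (d 2 f)) p)) -
   2 * b * d l (d k D) p = 0"
proof -
  have "d l (\<lambda>z. 1/4 * (D z * (2 * (w z * d k w z)) + d k D z * (w z)\<^sup>2) -
    2 * (d 1 (d 1 f) z * d k (d 2 (d 2 f)) z + d k (d 1 (d 1 f)) z * d 2 (d 2 f) z -
    2 * (d 1 (d 2 f) z * d k (d 1 (d 2 f)) z)) -
    b * (2 * (D z * d k D z))) p = 0"
    by (rule d_zero[OF p(1) _ d_constant_norm_equation]) (simp_all add: smooth_rules smooth_w smooth_D)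
  then show ?thesis
    using p base_values
    by (simp add: d_rules smooth_rules smooth_w smooth_D)
qed

lemma norm_values:
  assumes min: "\<And>z. z \<in> U \<Longrightarrow> (x p)\<^sup>2 + (y p)\<^sup>2 + (f p)\<^sup>2 \<le> (x z)\<^sup>2 + (y z)\<^sup>2 + (f z)\<^sup>2"
  shows "b = 0 \<or> b = 1/2"
proof -
  define r s t where "r = d 1 (d 1 f) p" and "s = d 1 (d 2 f) p" and "t = d 2 (d 2 f) p"
  \<comment> \<open>These two numbers will determine all third derivatives of \<open>f\<close> at
    \<open>p\<close>.\<close>
  define \<alpha> \<beta> where "\<alpha> = d 1 (d 1 (d 1 f)) p" and "\<beta> = d 1 (d 1 (d 2 f)) p"
  note sm = smooth_f smooth_d
  have dd: "d 2 (d 1 f) p = s"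
    using d_commute p(1) sm by (simp add: s_def)
  have fp: "f p = - 2 * (r + t)"
    using shrinker_equation[OF p(1)] p by (simp add: r_def t_def)
  have b: "b = r\<^sup>2 + 2 * s\<^sup>2 + t\<^sup>2"
    using constant_norm_equation[OF p(1)] p fp
    by (simp add: r_def[symmetric] s_def[symmetric] t_def[symmetric] power2_eq_square algebra_simps)
  \<comment> \<open>Commutation underneath one and two further derivatives, for comparing third and
    fourth derivatives whose indices are ordered differently.\<close>
  have swap: "d l (d 2 (d 1 u)) z = d l (d 1 (d 2 u)) z" if "z \<in> U" "smooth_on U u" for u l z
    by (rule deriv_along_cong[OF open_U that(1)]) (simp_all add: d_commute that)
  have swap2: "d l (d m (d 2 (d 1 u))) p = d l (d m (d 1 (d 2 u))) p" if "smooth_on U u" for u l m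
    by (rule deriv_along_cong[OF open_U p(1)]) (simp_all add: swap that)
  \<comment> \<open>At \<open>p\<close> the differentiated shrinker equation says that the Laplacian
    of \<open>f\<close> is critical.\<close>
  have "d 1 (d 2 (d 2 f)) p = - \<alpha>" "d 2 (d 2 (d 2 f)) p = - d 2 (d 1 (d 1 f)) p"
    using d_shrinker_equation[OF p(1), of 1] d_shrinker_equation[OF p(1), of 2] p base_values
    by (simp_all add: \<alpha>_def)
  moreover have "d 2 (d 1 (d 1 f)) p = \<beta>"
    using d_commute[of "d 1 f" p 2 1] swap[of p f 1] p(1) sm by (simp add: \<beta>_def)
  moreover have "d 2 (d 1 (d 2 f)) p = d 1 (d 2 (d 2 f)) p"
    using d_commute[of "d 2 f" p 2 1] p(1) sm by simp
  ultimately have third: "d 1 (d 2 (d 2 f)) p = - \<alpha>" "d 2 (d 2 (d 2 f)) p = - \<beta>"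
    "d 2 (d 1 (d 1 f)) p = \<beta>" "d 2 (d 1 (d 2 f)) p = - \<alpha>"
    by auto
  \<comment> \<open>First derivatives of the norm equation: a homogeneous linear system for \<alpha>
    and \<beta>. Its determinant is the squared difference of the principal curvatures, which
    vanishes exactly at an umbilic.\<close>
  have "(t - r) * \<alpha> = 2 * s * \<beta>" "(t - r) * \<beta> = - 2 * s * \<alpha>"
    using d_constant_norm_equation[OF p(1), of 1] d_constant_norm_equation[OF p(1), of 2]
      base_values third p
    by (simp_all add: r_def[symmetric] s_def[symmetric] t_def[symmetric] \<alpha>_def[symmetric]
        \<beta>_def[symmetric] algebra_simps)
  then have "((t - r)\<^sup>2 + 4 * s\<^sup>2) * \<alpha> = 0" "((t - r)\<^sup>2 + 4 * s\<^sup>2) * \<beta> = 0"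
    by algebra+
  then have cases: "(t = r \<and> s = 0) \<or> (\<alpha> = 0 \<and> \<beta> = 0)"
    by (auto simp: add_nonneg_eq_0_iff)
  have fourth: "d 2 (d 2 (d 1 (d 1 f))) p = d 1 (d 1 (d 2 (d 2 f))) p"
    "d 1 (d 2 (d 1 (d 1 f))) p = d 1 (d 1 (d 1 (d 2 f))) p"
    "d 1 (d 2 (d 2 (d 2 f))) p = d 2 (d 2 (d 1 (d 2 f))) p"
    using d_commute[of "d 2 (d 1 f)" p 2 1] swap[of p "d 1 f" 2] swap2[of f 1 2] swap[of p "d 2 f" 1]
      swap[of p "d 1 f" 1] swap2[of f 1 1] d_commute[of "d 2 (d 2 f)" p 1 2] swap[of p "d 2 f" 2]
      p(1) sm by simp_all
  \<comment> \<open>In the sum of \<open>N11\<close> and \<open>N22\<close>, the Laplacian of the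
    norm equation, fourth derivatives occur only as Laplacians of Hessian entries. The equations
    \<open>S11\<close>, \<open>S12\<close>, \<open>S22\<close> express these by the Hessian, while
    the third derivatives contribute
    \<open>8 * (\<alpha>\<^sup>2 + \<beta>\<^sup>2)\<close>.\<close>
  have simons: "b\<^sup>2 - b / 2 = 4 * (\<alpha>\<^sup>2 + \<beta>\<^sup>2)"
  proof -
    note w2 = dd_w[OF p(1-3)] and D2 = dd_D[OF p(1,4,5)]
    note S11 = dd_shrinker_equation[of 1 1] and S12 = dd_shrinker_equation[of 1 2]
      and S22 = dd_shrinker_equation[of 2 2]
      and N11 = dd_constant_norm_equation[of 1 1] and N22 = dd_constant_norm_equation[of 2 2]
    show ?thesis
      using S11 S12 S22 N11 N22
      unfolding w2 D2 dd fourth third r_def[symmetric] s_def[symmetric] t_def[symmetric]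
        \<alpha>_def[symmetric] \<beta>_def[symmetric] fp b
      by algebra
  qed
  have hess: "0 \<le> 2 + 2 * (f p * d k (d k f) p)" for k
  proof -
    let ?N = "\<lambda>z. (x z)\<^sup>2 + (y z)\<^sup>2 + (f z)\<^sup>2"
    have dN: "d k ?N z = 2 * x z * d k x z + 2 * y z * d k y z + 2 * f z * d k f z" if "z \<in> U" for z k
      using that by (simp add: d_rules smooth_rules)
    have "d k (d k ?N) p = d k (\<lambda>z. 2 * x z * d k x z + 2 * y z * d k y z + 2 * f z * d k f z) p"
      by (rule deriv_along_cong[OF open_U p(1) dN]) (simp_all add: smooth_rules)
    also have "\<dots> = 2 + 2 * (f p * d k (d k f) p)"
      using p exhaust_2[of k] by (auto simp: d_rules smooth_rules d_x d_y)
    finally show ?thesis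
      using second_derivative_test[of ?N p k] min p dN by (simp add: smooth_rules)
  qed
  show ?thesis
    using cases
  proof
    assume "t = r \<and> s = 0"
    \<comment> \<open>Here \<open>f p * r\<close> equals \<open>- 2 * b\<close>, so the Hessian test
      reads \<open>0 \<le> 2 - 4 * b\<close>.\<close>
    then have b2: "b = 2 * r\<^sup>2" and "f p = - 4 * r" using b fp by auto
    with hess[of 1] have "b \<le> 1/2"
      by (simp add: r_def[symmetric] power2_eq_square)
    moreover have "0 \<le> b * (b - 1/2)"
      using simons by (simp add: algebra_simps power2_eq_square)
    moreover have "0 \<le> b" using b2 by simp
    ultimately show ?thesis
      by (auto simp: zero_le_mult_iff)
  next
    assume "\<alpha> = 0 \<and> \<beta> = 0"
    with simons have "b * (b - 1/2) = 0"
      by (simp add: algebra_simps power2_eq_square)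
    then show ?thesis by auto
  qed
qed

end

end

section \<open>Immersed surfaces as graphs over a tangent plane\<close>

text \<open>Pull an orthonormal basis of the range back along \<open>h\<close>. This makes the
  choice in \<open>frame_at\<close> meaningful.\<close>

lemma orthonormal_frame_exists:
  fixes h :: "'e::euclidean_space \<Rightarrow> 'f::euclidean_space"
  assumes "linear h" "inj h"
  shows "\<exists>E. orthonormal_frame (\<lambda>v w. h v \<bullet> h w) E"
proof -
  have "subspace (range h)" using assms(1) by (simp add: linear_subspace_image)
  then obtain B where B: "B \<subseteq> range h" "pairwise orthogonal B" "\<And>x. x \<in> B \<Longrightarrow> norm x = 1"
    "card B = dim (range h)"
    by (rule orthonormal_basis_subspace) blast
  have "dim (range h) = DIM('e)"
    using dim_image_eq[OF assms(1), of UNIV] assms(2) by simp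
  moreover have "card (h -` B) = card B"
    using B(1) assms(2) by (simp add: card_vimage_inj)
  moreover have "h u \<bullet> h v = (if u = v then 1 else 0)" if "u \<in> h -` B" "v \<in> h -` B" for u v
    using that B(2) B(3)[of "h u"] assms(2)
    by (auto simp: pairwise_def orthogonal_def inj_eq norm_eq_1)
  ultimately have "orthonormal_frame (\<lambda>v w. h v \<bullet> h w) (h -` B)"
    unfolding orthonormal_frame_def using B(4) by auto
  then show ?thesis by blast
qed

lemma orthonormal_expansion:
  fixes e1 e2 n :: "real^3"
  assumes "norm e1 = 1" "norm e2 = 1" "norm n = 1" "e1 \<bullet> e2 = 0" "e1 \<bullet> n = 0" "e2 \<bullet> n = 0"
  shows "Y = (Y \<bullet> e1) *\<^sub>R e1 + (Y \<bullet> e2) *\<^sub>R e2 + (Y \<bullet> n) *\<^sub>R n"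
proof -
  have ne: "e1 \<noteq> e2" "e1 \<noteq> n" "e2 \<noteq> n"
    using assms by (auto simp: norm_eq_1)
  have "independent {e1, e2, n}"
    using assms by (intro pairwise_orthogonal_independent)
      (auto simp: pairwise_def orthogonal_def inner_commute)
  moreover have "dim (UNIV :: (real^3) set) \<le> card {e1, e2, n}"
    using ne by (simp add: dim_UNIV)
  ultimately have sp: "UNIV \<subseteq> span {e1, e2, n}"
    by (intro card_ge_dim_independent) auto
  \<comment> \<open>The remainder is orthogonal to a spanning set, hence to itself.\<close>
  define R where "R = Y - ((Y \<bullet> e1) *\<^sub>R e1 + (Y \<bullet> e2) *\<^sub>R e2 + (Y \<bullet> n) *\<^sub>R n)"
  have "orthogonal R v" if "v \<in> {e1, e2, n}" for v
    using that assms
    by (auto simp: R_def orthogonal_def norm_eq_1 inner_diff_left inner_add_left inner_diff_right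
        inner_add_right inner_commute)
  then have "orthogonal R R"
    using sp by (intro orthogonal_to_span[of R "{e1, e2, n}"]) auto
  then show ?thesis by (simp add: R_def orthogonal_self)
qed

text \<open>Here the rows \<open>(a\<^sub>1, a\<^sub>2)\<close>, \<open>(b\<^sub>1, b\<^sub>2)\<close> form a matrix \<open>P\<close> with \<open>P G P\<^sup>T = 1\<close> for
  \<open>G = 1 + p p\<^sup>T\<close>, and the conclusion spells out \<open>P\<^sup>T P = G\<^sup>-\<^sup>1\<close>.\<close>

lemma inverse_gram:
  fixes a1 a2 b1 b2 p q :: real
  assumes "a1 * a1 + a2 * a2 + (a1 * p + a2 * q) * (a1 * p + a2 * q) = 1"
    and "b1 * b1 + b2 * b2 + (b1 * p + b2 * q) * (b1 * p + b2 * q) = 1"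
    and "a1 * b1 + a2 * b2 + (a1 * p + a2 * q) * (b1 * p + b2 * q) = 0"
  defines "D \<equiv> 1 + p\<^sup>2 + q\<^sup>2"
  shows "D * (a1 * a1 + b1 * b1) = 1 + q\<^sup>2"
    and "D * (a1 * a2 + b1 * b2) = - (p * q)"
    and "D * (a2 * a2 + b2 * b2) = 1 + p\<^sup>2"
    and "D * (a1 * b2 - a2 * b1)\<^sup>2 = 1"
proof -
  \<comment> \<open>The determinant of \<open>P G P\<^sup>T = 1\<close>; the other three identities
    are derived from it.\<close>
  show det: "D * (a1 * b2 - a2 * b1)\<^sup>2 = 1"
    using assms(1-3) unfolding D_def by algebra
  show "D * (a1 * a1 + b1 * b1) = 1 + q\<^sup>2"
    using assms(1-3) det unfolding D_def by algebra
  show "D * (a1 * a2 + b1 * b2) = - (p * q)"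
    using assms(1-3) det unfolding D_def by algebra
  show "D * (a2 * a2 + b2 * b2) = 1 + p\<^sup>2"
    using assms(1-3) det unfolding D_def by algebra
qed

text \<open>A graph over the plane spanned by \<open>e1\<close> and \<open>e2\<close>, without
  reparametrisation: two components of \<open>F\<close> serve as coordinates on \<open>U\<close> and
  the component along \<open>n\<close> as the height function.\<close>

locale graph_chart =
  fixes U :: "(real^2) set" and F :: "real^2 \<Rightarrow> real^3" and e1 e2 n :: "real^3"
  assumes frame: "planar_frame U (\<lambda>z. F z \<bullet> e1) (\<lambda>z. F z \<bullet> e2)"
    and smooth_F: "smooth_on U F"
    and orthonormal: "norm e1 = 1" "norm e2 = 1" "norm n = 1" "e1 \<bullet> e2 = 0" "e1 \<bullet> n = 0" "e2 \<bullet> n = 0"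
begin

sublocale planar_frame U "\<lambda>z. F z \<bullet> e1" "\<lambda>z. F z \<bullet> e2"
  by (rule frame)

abbreviation f :: "real^2 \<Rightarrow> real" where "f z \<equiv> F z \<bullet> n"

abbreviation dF :: "real^2 \<Rightarrow> real^2 \<Rightarrow> real^3" where
  "dF z \<equiv> frechet_derivative F (at z)"

definition E :: "2 \<Rightarrow> real^3" where "E k = (if k = 1 then e1 else e2)"

definition slope :: "real^2 \<Rightarrow> real" where "slope z = 1 + (d 1 f z)\<^sup>2 + (d 2 f z)\<^sup>2"

text \<open>Normalising would bring in square roots; in this form all later identities are rational
  in the derivatives of the height.\<close>

definition \<nu> :: "real^2 \<Rightarrow> real^3" where "\<nu> z = n - d 1 f z *\<^sub>R e1 - d 2 f z *\<^sub>R e2"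

lemma slope_pos: "0 < slope z"
  by (simp add: slope_def add_pos_nonneg)

lemma smooth_f: "smooth_on U f"
  by (rule smooth_on_bounded_linear[OF open_U bounded_linear_inner_left smooth_F])

lemmas expansion = orthonormal_expansion[OF orthonormal]

lemma inner_simps': "e1 \<bullet> e1 = 1" "e2 \<bullet> e2 = 1" "n \<bullet> n = 1" "e1 \<bullet> e2 = 0" "e1 \<bullet> n = 0"
  "e2 \<bullet> n = 0" "e2 \<bullet> e1 = 0" "n \<bullet> e1 = 0" "n \<bullet> e2 = 0"
  using orthonormal by (auto simp: norm_eq_1 inner_commute)

lemma \<nu>_inner: "\<nu> z \<bullet> \<nu> z = slope z"
  by (simp add: \<nu>_def slope_def inner_diff_left inner_diff_right inner_simps' power2_eq_square)

lemma sum_squares: "(F z \<bullet> e1)\<^sup>2 + (F z \<bullet> e2)\<^sup>2 + (f z)\<^sup>2 = (norm (F z))\<^sup>2"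
proof -
  have "F z \<bullet> F z = F z \<bullet> ((F z \<bullet> e1) *\<^sub>R e1 + (F z \<bullet> e2) *\<^sub>R e2 + (F z \<bullet> n) *\<^sub>R n)"
    using expansion[of "F z"] by simp
  then show ?thesis
    unfolding power2_norm_eq_inner by (simp add: inner_add_right power2_eq_square)
qed

lemma dF_inner:
  assumes "z \<in> U"
  shows "dF z v \<bullet> a = frechet_derivative (\<lambda>z. F z \<bullet> a) (at z) v"
proof -
  have "((\<lambda>z. F z \<bullet> a) has_derivative (\<lambda>v. dF z v \<bullet> a)) (at z)"
    by (rule has_derivative_inner_left[OF smooth_on_has_derivative[OF smooth_F assms]])
  from frechet_derivative_at[OF this] show ?thesis by (simp add: fun_eq_iff)
qed

lemma linear_dF: "z \<in> U \<Longrightarrow> linear (dF z)"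
  using smooth_on_has_derivative[OF smooth_F] has_derivative_linear by blast

lemma dF_V:
  assumes "z \<in> U"
  shows "dF z (V k z) = E k + d k f z *\<^sub>R n"
proof -
  have "dF z (V k z) \<bullet> a = d k (\<lambda>z. F z \<bullet> a) z" for a
    using dF_inner[OF assms] by (simp add: deriv_along_def)
  then show ?thesis
    using expansion[of "dF z (V k z)"] d_x[OF assms] d_y[OF assms] exhaust_2[of k]
    by (auto simp: E_def)
qed

lemma dF_combination:
  assumes "z \<in> U"
  shows "dF z (a *\<^sub>R V 1 z + b *\<^sub>R V 2 z) = a *\<^sub>R e1 + b *\<^sub>R e2 + (a * d 1 f z + b * d 2 f z) *\<^sub>R n"
  using linear_dF[OF assms]
  by (simp add: linear_add linear_scale dF_V[OF assms] E_def algebra_simps)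

text \<open>A tangent vector is determined by its components along \<open>e1\<close> and
  \<open>e2\<close>; orthogonality to \<open>\<nu> z\<close> fixes the third component
  accordingly.\<close>

lemma tangent_space_eq:
  assumes "z \<in> U"
  shows "tangent_space F z = {Y. Y \<bullet> \<nu> z = 0}"
proof (intro equalityI subsetI)
  fix Y assume "Y \<in> tangent_space F z"
  then obtain v where "Y = dF z v" by (auto simp: tangent_space_def)
  then obtain a b where "Y = dF z (a *\<^sub>R V 1 z + b *\<^sub>R V 2 z)"
    using vector_decomp[OF assms, of v] by metis
  then show "Y \<in> {Y. Y \<bullet> \<nu> z = 0}"
    by (simp add: dF_combination[OF assms] \<nu>_def inner_simps' inner_add_left inner_diff_right)
next
  fix Y assume "Y \<in> {Y. Y \<bullet> \<nu> z = 0}"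
  then have "Y \<bullet> n = (Y \<bullet> e1) * d 1 f z + (Y \<bullet> e2) * d 2 f z"
    by (simp add: \<nu>_def inner_diff_right algebra_simps)
  with expansion[of Y] have "Y = dF z ((Y \<bullet> e1) *\<^sub>R V 1 z + (Y \<bullet> e2) *\<^sub>R V 2 z)"
    by (simp add: dF_combination[OF assms])
  then show "Y \<in> tangent_space F z" unfolding tangent_space_def by (rule range_eqI)
qed

lemma normal_part_eq:
  assumes "z \<in> U"
  shows "normal_part F z Y = (Y \<bullet> \<nu> z / slope z) *\<^sub>R \<nu> z"
  unfolding normal_part_def
proof (rule the_equality)
  let ?N = "(Y \<bullet> \<nu> z / slope z) *\<^sub>R \<nu> z"
  show N: "?N \<in> orthogonal_comp (tangent_space F z) \<and> Y - ?N \<in> tangent_space F z"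
    using slope_pos[of z]
    by (auto simp: tangent_space_eq[OF assms] orthogonal_comp_def orthogonal_def \<nu>_inner inner_diff_left
        inner_diff_right inner_commute)
  fix m assume m: "m \<in> orthogonal_comp (tangent_space F z) \<and> Y - m \<in> tangent_space F z"
  \<comment> \<open>Uniqueness: the difference of two candidates is both tangent and normal, hence
    0.\<close>
  have "(Y - m) - (Y - ?N) \<in> tangent_space F z"
    using m N by (simp add: tangent_space_eq[OF assms] inner_diff_left)
  then have "?N - m \<in> tangent_space F z" by (simp add: algebra_simps)
  moreover have "?N - m \<in> orthogonal_comp (tangent_space F z)"
    using m N by (auto simp: orthogonal_comp_def orthogonal_def inner_diff_right)
  ultimately have "(?N - m) \<bullet> (?N - m) = 0"
    by (auto simp: orthogonal_comp_def orthogonal_def)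
  then show "m = ?N" by simp
qed

lemma differentiable_V: "z \<in> U \<Longrightarrow> V k differentiable (at z)"
proof -
  assume z: "z \<in> U"
  have c: "(\<lambda>z. u z / jacobian z) differentiable (at z)" if "smooth_on U u" for u
    using smooth_on_has_derivative[OF smooth_on_divide[OF open_U that smooth_jacobian jacobian_neq_0] z]
    by (auto simp: differentiable_def)
  let ?x = "\<lambda>z. F z \<bullet> e1" and ?y = "\<lambda>z. F z \<bullet> e2"
  have V: "V k = (\<lambda>z.
      (if k = 1 then partial 2 ?y z / jacobian z else - partial 2 ?x z / jacobian z) *\<^sub>R axis 1 1 +
      (if k = 1 then - partial 1 ?y z / jacobian z else partial 1 ?x z / jacobian z) *\<^sub>R axis 2 1)"
    by (simp add: V_def fun_eq_iff algebra_simps)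
  show ?thesis
    unfolding V
    by (cases "k = 1") (auto intro!: derivative_intros c smooth_on_uminus[OF open_U]
        smooth_on_frechet_derivative smooth_x smooth_y)
qed

text \<open>The second vector is extended with constant coefficients in the frame \<open>V\<close>,
  as \<open>normal_part_flat_connection\<close> permits. The image of this field varies only in
  direction \<open>n\<close>, so its flat derivative is a multiple of \<open>n\<close> with a
  Hessian entry of the height as factor.\<close>

lemma second_ff_combination:
  assumes z: "z \<in> U"
  shows "second_ff F z (a *\<^sub>R V 1 z + b *\<^sub>R V 2 z) (a' *\<^sub>R V 1 z + b' *\<^sub>R V 2 z) =
    ((a * a' * d 1 (d 1 f) z + (a * b' + b * a') * d 1 (d 2 f) z + b * b' * d 2 (d 2 f) z) / slope z)
      *\<^sub>R \<nu> z"
proof -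
  let ?v = "a *\<^sub>R V 1 z + b *\<^sub>R V 2 z" and ?W = "\<lambda>z. a' *\<^sub>R V 1 z + b' *\<^sub>R V 2 z"
  let ?h = "\<lambda>z. a' * d 1 f z + b' * d 2 f z"
  have sm: "smooth_on U ?h"
    by (intro smooth_on_add smooth_on_mult smooth_on_const smooth_d smooth_f open_U)
  have "((\<lambda>z. a' *\<^sub>R e1 + b' *\<^sub>R e2 + ?h z *\<^sub>R n) has_derivative
      (\<lambda>v. frechet_derivative ?h (at z) v *\<^sub>R n)) (at z)"
    using has_derivative_add[OF has_derivative_const
        has_derivative_scaleR_left[OF smooth_on_has_derivative[OF sm z]]] by simp
  then have "((\<lambda>z. dF z (?W z)) has_derivative (\<lambda>v. frechet_derivative ?h (at z) v *\<^sub>R n)) (at z)"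
    by (rule has_derivative_transform_within_open[OF _ open_U z]) (simp add: dF_combination)
  then have flat: "flat_connection F ?v ?W z = frechet_derivative ?h (at z) ?v *\<^sub>R n"
    unfolding flat_connection_def by (simp flip: frechet_derivative_at)
  have "frechet_derivative ?h (at z) ?v = a * d 1 ?h z + b * d 2 ?h z"
    using linear_derivative[OF sm z] by (simp add: linear_add linear_scale deriv_along_def)
  moreover have "d k ?h z = a' * d k (d 1 f) z + b' * d k (d 2 f) z" for k
    using z by (simp add: deriv_along_add[OF z] deriv_along_mult[OF z] smooth_on_mult[OF open_U]
        smooth_on_const smooth_d smooth_f)
  ultimately have h: "frechet_derivative ?h (at z) ?v =
      a * a' * d 1 (d 1 f) z + (a * b' + b * a') * d 1 (d 2 f) z + b * b' * d 2 (d 2 f) z"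
    using d_commute[OF smooth_f z, of 2 1] by (simp add: algebra_simps)
  have "?W differentiable (at z)"
    using z by (auto intro!: derivative_intros differentiable_V)
  from normal_part_flat_connection[OF open_U z smooth_F this, of ?v]
  show ?thesis
    unfolding flat h normal_part_eq[OF z] by (simp add: \<nu>_def inner_diff_right inner_simps')
qed

text \<open>The first sum is the trace of the Hessian with respect to the inverse metric, supplied
  by \<open>inverse_gram\<close>. The second is the square of that trace minus twice the
  determinant.\<close>

lemma frame_traces:
  assumes z: "z \<in> U" and B: "orthonormal_frame (\<lambda>v w. dF z v \<bullet> dF z w) B"
  defines "S \<equiv> (1 + (d 2 f z)\<^sup>2) * d 1 (d 1 f) z - 2 * (d 1 f z * (d 2 f z * d 1 (d 2 f) z)) +
      (1 + (d 1 f z)\<^sup>2) * d 2 (d 2 f) z"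
  shows "(\<Sum>e\<in>B. second_ff F z e e) = (S / (slope z)\<^sup>2) *\<^sub>R \<nu> z"
    and "(slope z)^3 * (\<Sum>e\<in>B. \<Sum>e'\<in>B. (norm (second_ff F z e e'))\<^sup>2) =
      S\<^sup>2 - 2 * slope z * (d 1 (d 1 f) z * d 2 (d 2 f) z - (d 1 (d 2 f) z)\<^sup>2)"
proof -
  have "card B = 2" using B by (simp add: orthonormal_frame_def)
  then obtain u v where uv: "B = {u, v}" "u \<noteq> v" by (auto simp: card_2_iff)
  obtain a1 a2 where u: "u = a1 *\<^sub>R V 1 z + a2 *\<^sub>R V 2 z"
    using vector_decomp[OF z] by blast
  obtain b1 b2 where v: "v = b1 *\<^sub>R V 1 z + b2 *\<^sub>R V 2 z"
    using vector_decomp[OF z] by blast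
  let ?p = "d 1 f z" and ?q = "d 2 f z"
  define r s t where "r = d 1 (d 1 f) z" and "s = d 1 (d 2 f) z" and "t = d 2 (d 2 f) z"
  have G: "dF z u \<bullet> dF z u = 1" "dF z v \<bullet> dF z v = 1" "dF z u \<bullet> dF z v = 0"
    using B uv by (auto simp: orthonormal_frame_def)
  have "a1 * a1 + a2 * a2 + (a1 * ?p + a2 * ?q) * (a1 * ?p + a2 * ?q) = 1"
    "b1 * b1 + b2 * b2 + (b1 * ?p + b2 * ?q) * (b1 * ?p + b2 * ?q) = 1"
    "a1 * b1 + a2 * b2 + (a1 * ?p + a2 * ?q) * (b1 * ?p + b2 * ?q) = 0"
    using G unfolding u v dF_combination[OF z]
    by (simp_all add: inner_add_left inner_add_right inner_simps' mult.commute)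
  note I = inverse_gram[OF this, folded slope_def]
  define q where "q a b a' b' = a * a' * r + (a * b' + b * a') * s + b * b' * t" for a b a' b'
  have Q: "second_ff F z (a *\<^sub>R V 1 z + b *\<^sub>R V 2 z) (a' *\<^sub>R V 1 z + b' *\<^sub>R V 2 z) =
      (q a b a' b' / slope z) *\<^sub>R \<nu> z" for a b a' b'
    by (simp add: second_ff_combination[OF z] q_def r_def s_def t_def)
  have S: "S = slope z * (q a1 a2 a1 a2 + q b1 b2 b1 b2)"
    using I(1-3) unfolding S_def r_def[symmetric] s_def[symmetric] t_def[symmetric] q_def by algebra
  show "(\<Sum>e\<in>B. second_ff F z e e) = (S / (slope z)\<^sup>2) *\<^sub>R \<nu> z"
    using uv slope_pos[of z] unfolding u v S
    by (simp add: Q power2_eq_square flip: scaleR_add_left) (simp add: field_simps)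
  have "(norm (\<nu> z))\<^sup>2 = slope z" by (simp add: power2_norm_eq_inner \<nu>_inner)
  then have N: "(norm ((c / slope z) *\<^sub>R \<nu> z))\<^sup>2 = c\<^sup>2 / slope z" for c
    using slope_pos[of z] by (simp add: power_mult_distrib power_divide) (simp add: power2_eq_square)
  have "(\<Sum>e\<in>B. \<Sum>e'\<in>B. (norm (second_ff F z e e'))\<^sup>2) =
      ((q a1 a2 a1 a2)\<^sup>2 + (q a1 a2 b1 b2)\<^sup>2 + (q b1 b2 a1 a2)\<^sup>2 + (q b1 b2 b1 b2)\<^sup>2) / slope z"
    using uv unfolding u v by (simp add: Q N add_divide_distrib del: norm_scaleR)
  then have "slope z ^ 3 * (\<Sum>e\<in>B. \<Sum>e'\<in>B. (norm (second_ff F z e e'))\<^sup>2) =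
      (slope z)\<^sup>2 * ((q a1 a2 a1 a2)\<^sup>2 + (q a1 a2 b1 b2)\<^sup>2 + (q b1 b2 a1 a2)\<^sup>2 + (q b1 b2 b1 b2)\<^sup>2)"
    using slope_pos[of z] by (simp add: power3_eq_cube power2_eq_square)
  \<comment> \<open>The determinant of the form \<open>q\<close> in the frame is the Hessian
    determinant times the squared determinant of the change of basis.\<close>
  also have "\<dots> = S\<^sup>2 - 2 * (slope z)\<^sup>2 * ((a1 * b2 - a2 * b1)\<^sup>2 * (r * t - s\<^sup>2))"
    unfolding S q_def by algebra
  also have "\<dots> = S\<^sup>2 - 2 * slope z * (r * t - s\<^sup>2)"
    using I(4) by algebra
  finally show "(slope z)^3 * (\<Sum>e\<in>B. \<Sum>e'\<in>B. (norm (second_ff F z e e'))\<^sup>2) =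
      S\<^sup>2 - 2 * slope z * (d 1 (d 1 f) z * d 2 (d 2 f) z - (d 1 (d 2 f) z)\<^sup>2)"
    by (simp add: r_def s_def t_def)
qed

lemma shrinker_graph:
  assumes B: "\<And>z. z \<in> U \<Longrightarrow> orthonormal_frame (\<lambda>v w. dF z v \<bullet> dF z w) (B z)"
    and H: "\<And>z. z \<in> U \<Longrightarrow> (\<Sum>e\<in>B z. second_ff F z e e) = - (1/2) *\<^sub>R normal_part F z (F z)"
    and N: "\<And>z. z \<in> U \<Longrightarrow> (\<Sum>e\<in>B z. \<Sum>e'\<in>B z. (norm (second_ff F z e e'))\<^sup>2) = b"
  shows "shrinker_graph U (\<lambda>z. F z \<bullet> e1) (\<lambda>z. F z \<bullet> e2) f b"
proof
  show "smooth_on U f" by (rule smooth_f)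
  fix z assume z: "z \<in> U"
  let ?S = "(1 + (d 2 f z)\<^sup>2) * d 1 (d 1 f) z - 2 * (d 1 f z * (d 2 f z * d 1 (d 2 f) z)) +
      (1 + (d 1 f z)\<^sup>2) * d 2 (d 2 f) z"
  let ?w = "f z - F z \<bullet> e1 * d 1 f z - F z \<bullet> e2 * d 2 f z"
  have w: "F z \<bullet> \<nu> z = ?w" by (simp add: \<nu>_def inner_diff_right)
  have "\<nu> z \<noteq> 0" using \<nu>_inner[of z] slope_pos[of z] by auto
  moreover have "(?S / (slope z)\<^sup>2) *\<^sub>R \<nu> z = (- (1/2) * (?w / slope z)) *\<^sub>R \<nu> z"
    using H[OF z] unfolding frame_traces(1)[OF z B[OF z]] normal_part_eq[OF z] w by simp
  ultimately have "?S / (slope z)\<^sup>2 = - (1/2) * (?w / slope z)"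
    by (metis scaleR_cancel_right)
  then have S: "?S = - (1/2) * (slope z * ?w)"
    using slope_pos[of z] by (subst (asm) divide_eq_eq) (simp add: power2_eq_square)
  then show "?S + 1/2 * ((1 + (d 1 f z)\<^sup>2 + (d 2 f z)\<^sup>2) * ?w) = 0"
    by (simp add: slope_def)
  \<comment> \<open>Inserting the shrinker equation for the trace leaves a common factor
    \<open>slope z\<close>, which is then cancelled.\<close>
  have "slope z ^ 3 * b = (- (1/2) * (slope z * ?w))\<^sup>2 -
      2 * slope z * (d 1 (d 1 f) z * d 2 (d 2 f) z - (d 1 (d 2 f) z)\<^sup>2)"
    using frame_traces(2)[OF z B[OF z]] unfolding N[OF z] S .
  then have "slope z * (1/4 * (slope z * ?w\<^sup>2) -
      2 * (d 1 (d 1 f) z * d 2 (d 2 f) z - (d 1 (d 2 f) z)\<^sup>2) - b * (slope z)\<^sup>2) = 0"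
    by algebra
  then show "1/4 * ((1 + (d 1 f z)\<^sup>2 + (d 2 f z)\<^sup>2) * ?w\<^sup>2) -
      2 * (d 1 (d 1 f) z * d 2 (d 2 f) z - (d 1 (d 2 f) z)\<^sup>2) -
      b * (1 + (d 1 f z)\<^sup>2 + (d 2 f z)\<^sup>2)\<^sup>2 = 0"
    using slope_pos[of z] by (simp add: slope_def)
qed

end

section \<open>From an immersion to a graph over its tangent plane\<close>

lemma adapted_frame:
  fixes h :: "real^2 \<Rightarrow> real^3"
  assumes h: "linear h" "inj h"
  obtains e1 e2 n where
    "norm e1 = 1" "norm e2 = 1" "norm n = 1" "e1 \<bullet> e2 = 0" "e1 \<bullet> n = 0" "e2 \<bullet> n = 0"
    "e1 \<in> range h" "e2 \<in> range h" "\<forall>v. h v \<bullet> n = 0"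
    "(h (axis 1 1) \<bullet> e1) * (h (axis 2 1) \<bullet> e2) - (h (axis 2 1) \<bullet> e1) * (h (axis 1 1) \<bullet> e2) \<noteq> 0"
proof -
  have S: "subspace (range h)" using h(1) by (simp add: linear_subspace_image)
  have dim: "dim (range h) = 2"
    using dim_image_eq[OF h(1), of UNIV] h(2) by simp
  obtain B where B: "B \<subseteq> range h" "pairwise orthogonal B" "\<And>x. x \<in> B \<Longrightarrow> norm x = 1"
    "card B = dim (range h)"
    using S by (rule orthonormal_basis_subspace) blast
  then obtain e1 e2 where e: "B = {e1, e2}" "e1 \<noteq> e2"
    using dim by (auto simp: card_2_iff)
  have "dim (range h) < DIM(real^3)" using dim by simp
  from orthogonal_to_subspace_exists[OF this]
  obtain m where m: "m \<noteq> 0" "\<And>y. y \<in> span (range h) \<Longrightarrow> orthogonal m y"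
    by blast
  define n where "n = m /\<^sub>R norm m"
  have hn: "h v \<bullet> n = 0" for v
    using m(2)[of "h v"] by (simp add: n_def orthogonal_def span_base inner_commute)
  have N: "norm e1 = 1" "norm e2 = 1" "norm n = 1" "e1 \<bullet> e2 = 0" "e1 \<bullet> n = 0" "e2 \<bullet> n = 0"
    using B e m(1) hn by (auto simp: n_def pairwise_def orthogonal_def)
  have zero: "v = 0" if "h v \<bullet> e1 = 0" "h v \<bullet> e2 = 0" for v
  proof -
    have "h v = 0" using orthonormal_expansion[OF N, of "h v"] that hn by simp
    then show ?thesis using h linear_injective_0 by blast
  qed
  define a where "a i = h (axis i 1) \<bullet> e1" for i
  define b where "b i = h (axis i 1) \<bullet> e2" for i
  have "a 1 * b 2 - a 2 * b 1 \<noteq> 0"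
  proof
    assume J: "a 1 * b 2 - a 2 * b 1 = 0"
    have hv: "h (s *\<^sub>R axis 1 1 + t *\<^sub>R axis 2 1) \<bullet> e1 = s * a 1 + t * a 2"
      "h (s *\<^sub>R axis 1 1 + t *\<^sub>R axis 2 1) \<bullet> e2 = s * b 1 + t * b 2" for s t
      using h(1) by (simp_all add: linear_add linear_scale inner_add_left a_def b_def)
    have comp: "s = 0 \<and> t = 0" if "s *\<^sub>R axis 1 1 + t *\<^sub>R axis 2 1 = (0 :: real^2)" for s t :: real
      using that by (simp add: vec_eq_iff forall_2 axis_def)
    \<comment> \<open>With zero determinant the cofactor vectors lie in the kernel of
      \<open>h\<close>, so all entries vanish and then \<open>axis 1 1\<close> is in the kernel as
      well.\<close>
    have "b 2 *\<^sub>R axis 1 1 + (- b 1) *\<^sub>R axis 2 1 = (0 :: real^2)"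
      by (rule zero) (use J in \<open>simp_all only: hv, simp_all add: algebra_simps\<close>)
    from comp[OF this] have b: "b 1 = 0" "b 2 = 0" by auto
    have "a 2 *\<^sub>R axis 1 1 + (- a 1) *\<^sub>R axis 2 1 = (0 :: real^2)"
      by (rule zero) (use J in \<open>simp_all only: hv, simp_all add: algebra_simps b\<close>)
    from comp[OF this] have a: "a 1 = 0" "a 2 = 0" by auto
    have "1 *\<^sub>R axis 1 1 + 0 *\<^sub>R axis 2 1 = (0 :: real^2)"
      by (rule zero) (simp_all only: hv, simp_all add: a b)
    from comp[OF this] show False by simp
  qed
  then show thesis
    using that[OF N] hn B(1) e by (auto simp: a_def b_def)
qed

text \<open>The tangent plane at \<open>p\<close> serves as reference plane. The Jacobian of the
  projection to it is nonzero at \<open>p\<close>, hence on a neighbourhood \<open>U\<close>, where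
  the surface is a graph.\<close>

lemma immersed_shrinker_norm:
  fixes F :: "real^2 \<Rightarrow> real^3" and b :: real
  assumes W: "open W" "p \<in> W" and F: "smooth_on W F"
    and inj: "\<And>z. z \<in> W \<Longrightarrow> inj (frechet_derivative F (at z))"
    and B: "\<And>z. z \<in> W \<Longrightarrow>
      orthonormal_frame (\<lambda>v w. frechet_derivative F (at z) v \<bullet> frechet_derivative F (at z) w) (B z)"
    and H: "\<And>z. z \<in> W \<Longrightarrow> (\<Sum>e\<in>B z. second_ff F z e e) = - (1/2) *\<^sub>R normal_part F z (F z)"
    and N: "\<And>z. z \<in> W \<Longrightarrow> (\<Sum>e\<in>B z. \<Sum>e'\<in>B z. (norm (second_ff F z e e'))\<^sup>2) = b"
    and min: "\<And>z. z \<in> W \<Longrightarrow> norm (F p) \<le> norm (F z)"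
  shows "b = 0 \<or> b = 1/2"
proof -
  let ?h = "frechet_derivative F (at p)"
  note Fp = smooth_on_has_derivative[OF F W(2)]
  obtain e1 e2 n where
    e: "norm e1 = 1" "norm e2 = 1" "norm n = 1" "e1 \<bullet> e2 = 0" "e1 \<bullet> n = 0" "e2 \<bullet> n = 0"
      and tangent: "e1 \<in> range ?h" "e2 \<in> range ?h" and hn: "\<forall>v. ?h v \<bullet> n = 0"
      and J: "(?h (axis 1 1) \<bullet> e1) * (?h (axis 2 1) \<bullet> e2) -
        (?h (axis 2 1) \<bullet> e1) * (?h (axis 1 1) \<bullet> e2) \<noteq> 0"
    by (rule adapted_frame[OF has_derivative_linear[OF Fp] inj[OF W(2)]]) blast
  have inner: "frechet_derivative (\<lambda>z. F z \<bullet> a) (at z) v = frechet_derivative F (at z) v \<bullet> a"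
    if "z \<in> W" for z a v
    using frechet_derivative_at[OF has_derivative_inner_left[OF smooth_on_has_derivative[OF F that]], of a]
    by (simp add: fun_eq_iff)
  have sm: "smooth_on W (\<lambda>z. F z \<bullet> a)" for a
    by (rule smooth_on_bounded_linear[OF W(1) bounded_linear_inner_left F])
  let ?D = "\<lambda>a i z. frechet_derivative (\<lambda>z. F z \<bullet> a) (at z) (axis i 1)"
  define j where "j z = ?D e1 1 z * ?D e2 2 z - ?D e1 2 z * ?D e2 1 z" for z
  define U where "U = W \<inter> j -` (- {0})"
  have "smooth_on W j"
    unfolding j_def[abs_def]
    by (intro smooth_on_diff smooth_on_mult smooth_on_frechet_derivative sm W(1))
  then have oU: "open U"
    unfolding U_def by (intro continuous_open_preimage smooth_on_continuous_on W(1)) auto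
  have UW: "U \<subseteq> W" by (auto simp: U_def)
  have pU: "p \<in> U" using W(2) J by (simp add: U_def j_def inner)
  interpret graph_chart U F e1 e2 n
  proof (intro graph_chart.intro planar_frame.intro oU smooth_on_subset[OF sm UW]
      smooth_on_subset[OF F UW] e)
    show "?D e1 1 z * ?D e2 2 z - ?D e1 2 z * ?D e2 1 z \<noteq> 0" if "z \<in> U" for z
      using that by (simp add: U_def j_def)
  qed
  interpret shrinker_graph U "\<lambda>z. F z \<bullet> e1" "\<lambda>z. F z \<bullet> e2" "\<lambda>z. F z \<bullet> n" b
    by (rule shrinker_graph[of B]) (use UW B H N in auto)
  \<comment> \<open>The differential of the squared norm vanishes at its minimum, so
    \<open>F p\<close> is normal and both graph coordinates of \<open>p\<close> are 0.\<close>
  have "(\<lambda>v. F p \<bullet> ?h v + ?h v \<bullet> F p) = (\<lambda>v. 0)"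
    by (rule differential_zero_maxmin[OF W(2,1) has_derivative_inner[OF Fp Fp]])
      (use min in \<open>auto simp: norm_le\<close>)
  then have normal: "F p \<bullet> ?h v = 0" for v
    by (drule_tac fun_cong[of _ _ v]) (simp add: inner_commute)
  have "d k (\<lambda>z. F z \<bullet> n) p = 0" for k
    using hn by (simp add: deriv_along_def inner[OF W(2)])
  moreover have "F p \<bullet> e1 = 0" "F p \<bullet> e2 = 0"
    using tangent normal by auto
  moreover have "(F p \<bullet> e1)\<^sup>2 + (F p \<bullet> e2)\<^sup>2 + (F p \<bullet> n)\<^sup>2 \<le>
      (F z \<bullet> e1)\<^sup>2 + (F z \<bullet> e2)\<^sup>2 + (F z \<bullet> n)\<^sup>2" if "z \<in> U" for z
    unfolding sum_squares using min UW that by (intro power_mono) auto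
  ultimately show ?thesis
    using norm_values[OF pU] by blast
qed

theorem theorem4p2:
  fixes M :: "'a topology"
    and A :: "('a, real^2) chart set"
    and g :: "('a, real^2) metric_tensor"
    and X :: "'a \<Rightarrow> real^3"
  assumes "smooth_manifold M A"
    and "riemannian_metric A g"
    and "isometric_immersion A g X"
    and "complete_riemannian M A g"
    and "proper_map M euclidean X"
    and "self_shrinker A g X"
    and "\<exists>b. \<forall>c\<in>A. \<forall>p\<in>fst c. sff_norm_sq g X c p = b"
  shows "(\<forall>c\<in>A. \<forall>p\<in>fst c. sff_norm_sq g X c p = 0) \<or>
         (\<forall>c\<in>A. \<forall>p\<in>fst c. sff_norm_sq g X c p = 1/2)"
\<comment> \<open>An empty surface has no point nearest to the origin, but then the claim is
  vacuous.\<close>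
proof (cases "topspace M = {}")
  case True
  then have "fst c = {}" if "c \<in> A" for c
    using assms(1) that by (auto simp: smooth_manifold_def)
  then show ?thesis by simp
next
  case False
  obtain b where b: "\<And>c p. c \<in> A \<Longrightarrow> p \<in> fst c \<Longrightarrow> sff_norm_sq g X c p = b"
    using assms(7) by blast
  \<comment> \<open>Properness enters here: the image is closed, so some point of it is nearest to
    the origin.\<close>
  have "closed (X ` topspace M)"
    using proper_imp_closed_map[OF assms(5)] by (simp add: closed_map_def)
  moreover have "X ` topspace M \<noteq> {}" using False by blast
  ultimately have "\<exists>Y\<in>X ` topspace M. \<forall>Z\<in>X ` topspace M. dist 0 Y \<le> dist 0 Z"
    by (rule distance_attains_inf) blast
  then obtain q where q: "q \<in> topspace M" "\<And>r. r \<in> topspace M \<Longrightarrow> norm (X q) \<le> norm (X r)"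
    by auto
  moreover have "(\<Union>c\<in>A. fst c) = topspace M"
    using assms(1) by (simp add: smooth_manifold_def)
  ultimately obtain c where c: "c \<in> A" "q \<in> fst c"
    by blast
  define W where "W = snd c ` fst c"
  let ?F = "local_rep X c"
  have chart: "is_chart M c" using assms(1) c by (simp add: smooth_manifold_def)
  then have sub: "fst c \<subseteq> topspace M" by (simp add: is_chart_def openin_subset)
  have "inj_on (snd c) (fst c)"
    using chart homeomorphic_imp_injective_map[of "subtopology M (fst c)" _ "snd c"] sub
    by (auto simp: is_chart_def topspace_subtopology Int_absorb1)
  then have inv: "chart_inv c (snd c r) = r" if "r \<in> fst c" for r
    using that by (simp add: chart_inv_def)
  have W: "open W" "snd c q \<in> W" using chart c by (auto simp: W_def is_chart_def)
  have F: "smooth_on W ?F" "\<And>r. r \<in> fst c \<Longrightarrow> inj (frechet_derivative ?F (at (snd c r)))"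
    "\<And>r v w. r \<in> fst c \<Longrightarrow> g c r v w =
      frechet_derivative ?F (at (snd c r)) v \<bullet> frechet_derivative ?F (at (snd c r)) w"
    using assms(3) c by (auto simp: isometric_immersion_def W_def Let_def)
  have FX: "?F (snd c r) = X r" if "r \<in> fst c" for r
    using inv[OF that] by (simp add: local_rep_def)
  have "b = 0 \<or> b = 1/2"
  \<comment> \<open>A single chart around the nearest point suffices, since \<open>b\<close> is the
    same constant in every chart.\<close>
  proof (rule immersed_shrinker_norm[OF W F(1), of "\<lambda>z. frame_at g c (chart_inv c z)"])
    fix z assume "z \<in> W"
    then obtain r where r: "r \<in> fst c" "z = snd c r" by (auto simp: W_def)
    let ?h = "frechet_derivative ?F (at z)"
    have lin: "linear ?h"
      using smooth_on_has_derivative[OF F(1) \<open>z \<in> W\<close>] by (rule has_derivative_linear)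
    show "inj ?h" using F(2)[OF r(1)] r(2) by simp
    have "g c r = (\<lambda>v w. ?h v \<bullet> ?h w)" using F(3)[OF r(1)] r(2) by (simp add: fun_eq_iff)
    then show "orthonormal_frame (\<lambda>v w. ?h v \<bullet> ?h w) (frame_at g c (chart_inv c z))"
      using orthonormal_frame_exists[OF lin \<open>inj ?h\<close>] inv[OF r(1)] r(2)
      by (simp add: frame_at_def someI_ex)
    show "(\<Sum>e\<in>frame_at g c (chart_inv c z). second_ff ?F z e e) =
        - (1/2) *\<^sub>R normal_part ?F z (?F z)"
      using assms(6) c(1) r inv[OF r(1)] FX[OF r(1)]
      by (simp add: self_shrinker_def mean_curvature_def)
    show "(\<Sum>e\<in>frame_at g c (chart_inv c z). \<Sum>e'\<in>frame_at g c (chart_inv c z).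
        (norm (second_ff ?F z e e'))\<^sup>2) = b"
      using b[OF c(1) r(1)] r inv[OF r(1)] by (simp add: sff_norm_sq_def)
    show "norm (?F (snd c q)) \<le> norm (?F z)"
      using q(2)[of r] sub r FX c(2) by auto
  qed
  with b show ?thesis by auto
qed

end
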